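(* For every fixed $\varepsilon>0$ there exists $p_0=p_0(\varepsilon)$ such that the following holds. Let $p\ge p_0$ be a prime, let $g$ be an integer with $\gcd(g,p)=1$ and let $T$ be the multiplicative order of $g$ modulo $p$. Let $\mathcal{N}=\{u+1,\ldots,u+N\}$ and $\mathcal{M}=\{v+1,\ldots,v+M\}$ be intervals of consecutive integers ($u,v\in\mathbb{Z}$) with $N\le p$, $M\le T$ and $$ N>p^{1/3+\varepsilon},\qquad M>p^{1/3+\varepsilon}. $$ Then for any integer $\lambda$ there exist $x_1,\ldots,x_8\in\mathcal{N}$ and $y_1,\ldots,y_8\in\mathcal{M}$ such that $$ x_1g^{y_1}+\cdots+x_8g^{y_8}\equiv\lambda\pmod p. $$
   Context: For a positive integer $k$, $g^{-k}$ denotes an integer with $g^{-k}g^{k}\equiv 1\pmod p$. *)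

theory Defs
  imports
    Complex_Main
    "HOL-Number_Theory.Number_Theory"
    "HOL-Number_Theory.Modular_Inverse"
begin

text \<open>
  Integer powers modulo \<open>p\<close>. A negative power is only determined up to congruence
  modulo \<open>p\<close>; the representative is the library's \<open>modular_inverse\<close>. The value is meaningful
  only if \<open>g\<close> and \<open>p\<close> are coprime (see \<open>mod_powi_minus_cong\<close>).
\<close>

definition mod_powi :: "int \<Rightarrow> int \<Rightarrow> int \<Rightarrow> int" where
  "mod_powi p g y = (if 0 \<le> y then g ^ nat y else modular_inverse p (g ^ nat (- y)))"

lemma mod_powi_of_nat: "mod_powi p g (int k) = g ^ k"
  by (simp add: mod_powi_def)

lemma mod_powi_minus_cong:
  assumes "coprime g p"
  shows "[mod_powi p g (- int k) * g ^ k = 1] (mod p)"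
proof (cases "k = 0")
  case True
  then show ?thesis
    by (simp add: mod_powi_def)
next
  case False
  then show ?thesis
    using assms cong_modular_inverse2[of "g ^ k" p] by (simp add: mod_powi_def)
qed

end

theory Submission
  imports Defs "HOL-Analysis.Convex"
begin

text \<open>
  Take \<open>m\<close> of size about \<open>p\<close> to the power \<open>1/3 + \<epsilon>\<close> and let \<open>A\<close> be the set of the \<open>x g\<^sup>k\<close> with \<open>x\<close> in an
  interval of length \<open>m\<close> and \<open>1 \<le> k \<le> m\<close>, and \<open>B\<close> the set of the \<open>g\<^sup>l\<close> with \<open>0 \<le> l < m\<close>. Glibichuk's
  theorem says that eight products from \<open>A \<times> B\<close> represent every residue as soon as
  \<open>|A||B| \<ge> 2p\<close> and \<open>B\<close> is disjoint from \<open>-B\<close>; so it suffices that \<open>|A|\<close> is almost \<open>m\<^sup>2\<close>.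
  Taking differences of the \<open>x\<close>, this follows from an almost linear bound (in \<open>m\<^sup>2\<close>) for the number \<open>J(m)\<close>
  of solutions of \<open>z g\<^sup>k \<equiv> w g\<^sup>l\<close> with \<open>|z|, |w| \<le> m\<close> and \<open>1 \<le> k, l \<le> m\<close>. Such a bound comes from playing two
  inequalities against each other: Cauchy-Schwarz and the divisor bound give
  \<open>J(m)\<^sup>2 \<le> m D\<^sup>2 J(m\<^sup>2)\<close> with \<open>J(m\<^sup>2)\<close> counting \<open>|z|, |w| \<le> m\<^sup>2\<close>, while counting points of the lattices
  \<open>z g\<^sup>k \<equiv> w g\<^sup>l\<close> at the scales \<open>m\<close> and \<open>m\<^sup>2\<close> bounds \<open>J(m\<^sup>2)\<close> linearly in \<open>J(m)\<close>. The
  exponent \<open>1/3\<close> enters because the main term \<open>m\<^sup>4/p\<close> of the lattice count at scale \<open>m\<^sup>2\<close> is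
  close to \<open>m\<close> when \<open>m\<^sup>3\<close> is close to \<open>p\<close>.
\<close>

subsection \<open>Eightfold sums of products\<close>

lemma card_le_image_times_fiber:
  fixes f :: "'a \<Rightarrow> 'b" and c :: real
  assumes "finite S" and "finite R" and "f ` S \<subseteq> R"
    and "\<And>r. r \<in> R \<Longrightarrow> real (card {s \<in> S. f s = r}) \<le> c"
  shows "real (card S) \<le> c * real (card R)"
proof -
  have "real (card S) = (\<Sum>r\<in>R. real (card {s \<in> S. f s = r}))"
    using sum.group[OF assms(1-3), of "\<lambda>_. 1::real"] by simp
  also have "\<dots> \<le> (\<Sum>r\<in>R. c)"
    using assms(4) by (intro sum_mono)
  finally show ?thesis by (simp add: mult.commute)
qed

text \<open>Cauchy-Schwarz applied to the fibre sizes: they sum to \<open>card S\<close>, and their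
  squares sum to the number of colliding pairs.\<close>

lemma card_squared_le_image_times_collisions:
  fixes f :: "'a \<Rightarrow> 'b"
  assumes "finite S"
  shows "(card S)\<^sup>2 \<le> card (f ` S) * card {(s, t) \<in> S \<times> S. f s = f t}"
proof -
  define F where "F r = {s \<in> S. f s = r}" for r
  have fin: "finite (F r)" for r
    using assms by (simp add: F_def)
  have S: "real (card S) = (\<Sum>r\<in>f ` S. real (card (F r)))"
    using sum.group[OF assms finite_imageI[OF assms] subset_refl[of "f ` S"], of "\<lambda>_. 1::real"]
    by (simp add: F_def)
  have "{(s, t) \<in> S \<times> S. f s = f t} = (\<Union>r\<in>f ` S. F r \<times> F r)"
    by (auto simp: F_def)
  then have "card {(s, t) \<in> S \<times> S. f s = f t} = (\<Sum>r\<in>f ` S. card (F r \<times> F r))"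
    using assms fin by (simp only:, subst card_UN_disjoint) (auto simp: F_def)
  then have "real (card {(s, t) \<in> S \<times> S. f s = f t}) = (\<Sum>r\<in>f ` S. (real (card (F r)))\<^sup>2)"
    by (simp add: power2_eq_square card_cartesian_product)
  then have "(real (card S))\<^sup>2 \<le> real (card (f ` S)) * real (card {(s, t) \<in> S \<times> S. f s = f t})"
    using Cauchy_Schwarz_ineq_sum[of "\<lambda>_. 1" "\<lambda>r. real (card (F r))" "f ` S"] S by simp
  then show ?thesis
    unfolding of_nat_mult[symmetric] of_nat_power[symmetric] of_nat_le_iff .
qed

text \<open>Pigeonhole: \<open>X\<close> and its reflection \<open>lam - X\<close> both fill more
  than half of the residues, so they meet.\<close>

lemma sum_of_two_large_sets:
  fixes p lam :: int
  assumes "p > 0" and "X \<subseteq> {0..<p}" and "2 * int (card X) > p"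
  obtains x y where "x \<in> X" and "y \<in> X" and "[x + y = lam] (mod p)"
proof -
  define Y where "Y = (\<lambda>x. (lam - x) mod p) ` X"
  have "inj_on (\<lambda>x. (lam - x) mod p) X"
  proof (rule inj_onI)
    fix x y
    assume xy: "x \<in> X" "y \<in> X" "(lam - x) mod p = (lam - y) mod p"
    then have "[x = y] (mod p)"
      by (simp add: mod_eq_dvd_iff cong_iff_dvd_diff dvd_diff_commute)
    then show "x = y"
      using xy(1,2) assms(2) by (meson atLeastLessThan_iff cong_less_imp_eq_int subsetD)
  qed
  then have cY: "card Y = card X"
    by (simp add: Y_def card_image)
  have Y: "Y \<subseteq> {0..<p}"
    using assms(1) by (auto simp: Y_def)
  have "X \<inter> Y \<noteq> {}"
  proof
    assume "X \<inter> Y = {}"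
    then have "card X + card Y = card (X \<union> Y)"
      using assms(2) Y by (subst card_Un_disjoint) (auto intro: finite_subset)
    also have "\<dots> \<le> card {0..<p}"
      using assms(2) Y by (intro card_mono) auto
    finally show False
      using assms(1,3) cY by simp
  qed
  then obtain x y where "x \<in> X" "y \<in> X" "x = (lam - y) mod p"
    by (auto simp: Y_def)
  moreover from this have "[x + y = lam] (mod p)"
    by (simp add: cong_def mod_simps)
  ultimately show ?thesis
    using that by blast
qed

section \<open>Sums of a set and a dilate modulo a prime\<close>

definition dilate_sum :: "int \<Rightarrow> int set \<Rightarrow> int set \<Rightarrow> int \<Rightarrow> int set" where
  "dilate_sum p A B t = (\<lambda>(a, b). (a + t * b) mod p) ` (A \<times> B)"

text \<open>The additive energy between \<open>A\<close> and \<open>t B\<close>. It controls the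
  size of \<open>dilate_sum\<close> from below through Cauchy-Schwarz.\<close>

definition dilate_energy :: "int \<Rightarrow> int set \<Rightarrow> int set \<Rightarrow> int \<Rightarrow> nat" where
  "dilate_energy p A B t =
     card {(s, s') \<in> (A \<times> B) \<times> (A \<times> B). (fst s + t * snd s) mod p = (fst s' + t * snd s') mod p}"

text \<open>Exchanging the two elements of \<open>B\<close> moves each of them to the other side of
  the congruence. Hence one \<open>t\<close> of small energy serves both \<open>A + tB\<close> and
  \<open>A - tB\<close>.\<close>

lemma dilate_energy_uminus: "dilate_energy p A B (- t) = dilate_energy p A B t"
proof -
  have *: "(a + t * b) mod p = (c + t * d) mod p \<longleftrightarrow> (a + - t * d) mod p = (c + - t * b) mod p"
    for a b c d
    by (simp add: mod_eq_dvd_iff algebra_simps)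
  show ?thesis
    unfolding dilate_energy_def
    by (rule bij_betw_same_card[of "\<lambda>((a, b), (c, d)). ((a, d), (c, b))"],
        rule bij_betwI[where g = "\<lambda>((a, b), (c, d)). ((a, d), (c, b))"])
       (use * in auto)
qed

text \<open>Averaging over the nonzero residues \<open>t\<close>. A diagonal pair of elements of
  \<open>A \<times> B\<close> collides for all \<open>p - 1\<close> values of \<open>t\<close>, any
  other pair for at most one, so some \<open>t\<close> does at most as badly as the mean.\<close>

lemma exists_small_dilate_energy:
  fixes p :: int
  assumes "prime p" and "A \<subseteq> {0..<p}" and "B \<subseteq> {0..<p}"
  defines "n \<equiv> int (card A * card B)"
  obtains t where "0 < t" and "t < p" and "(p - 1) * int (dilate_energy p A B t) \<le> n * (p - 1) + n\<^sup>2"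
proof -
  have p: "p > 1"
    using assms(1) by (simp add: prime_gt_1_int)
  define S where "S = A \<times> B"
  have finS: "finite S"
    unfolding S_def using assms(2,3) by (intro finite_cartesian_product) (auto intro: finite_subset)
  have n: "n = int (card S)"
    by (simp add: n_def S_def card_cartesian_product)
  define P where "P t s s' \<longleftrightarrow> (fst s + t * snd s) mod p = (fst s' + t * snd s') mod p" for t s s'
  \<comment> \<open>Two solutions \<open>t\<close>, \<open>t'\<close> give a multiple
    \<open>(t - t') * (b - d)\<close> of \<open>p\<close>. If \<open>p\<close> divides
    \<open>b - d\<close>, it also divides \<open>a - c\<close>, and then the two pairs coincide
    because their entries are reduced residues.\<close>
  have one: "card {t \<in> {0<..<p}. P t s s'} \<le> 1" if "s \<in> S" "s' \<in> S" "s \<noteq> s'" for s s'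
  proof -
    obtain a b c d where s: "s = (a, b)" "s' = (c, d)"
      by fastforce
    have "t = t'" if t: "t \<in> {0<..<p}" "t' \<in> {0<..<p}" "P t s s'" "P t' s s'" for t t'
    proof -
      have 1: "p dvd (a - c) + t * (b - d)" "p dvd (a - c) + t' * (b - d)"
        using t(3,4) by (simp_all add: P_def s mod_eq_dvd_iff algebra_simps)
      then have "p dvd ((a - c) + t * (b - d)) - ((a - c) + t' * (b - d))"
        by (rule dvd_diff)
      then have "p dvd (t - t') * (b - d)"
        by (simp add: algebra_simps)
      then consider "p dvd t - t'" | "p dvd b - d"
        using assms(1) prime_dvd_mult_iff by blast
      then show ?thesis
      proof cases
        case 1
        then show ?thesis
          using t(1,2) by (metis atLeastLessThan_iff cong_iff_dvd_diff cong_less_imp_eq_int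
              greaterThanLessThan_iff less_imp_le)
      next
        case 2
        then have "p dvd a - c"
          using 1 by (metis dvd_add_left_iff dvd_mult)
        then have "a = c" "b = d"
          using 2 \<open>s \<in> S\<close> \<open>s' \<in> S\<close> assms(2,3) s
          by (metis (no_types) S_def atLeastLessThan_iff cong_iff_dvd_diff cong_less_imp_eq_int
              mem_Sigma_iff subsetD)+
        then show ?thesis
          using \<open>s \<noteq> s'\<close> s by simp
      qed
    qed
    moreover have "finite {t \<in> {0<..<p}. P t s s'}"
      by (rule finite_subset[of _ "{0<..<p}"]) auto
    ultimately show ?thesis
      unfolding One_nat_def by (subst card_le_Suc0_iff_eq) auto
  qed
  have "(\<Sum>t\<in>{0<..<p}. int (dilate_energy p A B t))
      = (\<Sum>t\<in>{0<..<p}. \<Sum>s\<in>S. \<Sum>s'\<in>S. if P t s s' then 1 else 0)"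
  proof (rule sum.cong[OF refl])
    fix t
    have "{(s, s') \<in> S \<times> S. P t s s'} = (SIGMA s:S. {s' \<in> S. P t s s'})"
      by auto
    then have "int (dilate_energy p A B t) = (\<Sum>s\<in>S. int (card {s' \<in> S. P t s s'}))"
      using finS by (simp add: dilate_energy_def S_def[symmetric] P_def[symmetric] card_SigmaI)
    then show "int (dilate_energy p A B t) = (\<Sum>s\<in>S. \<Sum>s'\<in>S. if P t s s' then 1 else 0)"
      using finS by (simp add: sum.If_cases Int_def)
  qed
  also have "\<dots> = (\<Sum>s\<in>S. \<Sum>s'\<in>S. \<Sum>t\<in>{0<..<p}. if P t s s' then 1 else 0)"
    by (subst sum.swap, rule sum.cong[OF refl], rule sum.swap)
  also have "\<dots> = (\<Sum>s\<in>S. \<Sum>s'\<in>S. int (card {t \<in> {0<..<p}. P t s s'}))"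
    by (simp add: sum.If_cases Int_def)
  \<comment> \<open>The diagonal is charged \<open>p\<close> instead of \<open>p - 1\<close>, which
    lets the off-diagonal bound \<open>1\<close> be summed over all \<open>n\<^sup>2\<close>
    pairs.\<close>
  also have "\<dots> \<le> (\<Sum>s\<in>S. \<Sum>s'\<in>S. (if s' = s then p - 1 else 0) + 1)"
  proof (intro sum_mono)
    fix s s'
    assume "s \<in> S" "s' \<in> S"
    moreover have "card {t \<in> {0<..<p}. P t s s} \<le> card {0<..<p}"
      by (intro card_mono) auto
    ultimately show "int (card {t \<in> {0<..<p}. P t s s'}) \<le> (if s' = s then p - 1 else 0) + 1"
      using one[of s s'] p by (cases "s' = s") auto
  qed
  also have "\<dots> = n * (p - 1) + n\<^sup>2"
    using finS by (simp add: sum.distrib n power2_eq_square algebra_simps)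
  finally have le: "(\<Sum>t\<in>{0<..<p}. int (dilate_energy p A B t)) \<le> n * (p - 1) + n\<^sup>2" .
  have "\<exists>t\<in>{0<..<p}. (p - 1) * int (dilate_energy p A B t) \<le> n * (p - 1) + n\<^sup>2"
  proof (rule ccontr)
    assume "\<not> ?thesis"
    moreover have "1 \<in> {0<..<p}"
      using p by simp
    then have "{0<..<p} \<noteq> {}"
      by blast
    ultimately have "(\<Sum>t\<in>{0<..<p}. n * (p - 1) + n\<^sup>2) < (\<Sum>t\<in>{0<..<p}. (p - 1) * int (dilate_energy p A B t))"
      using p by (intro sum_strict_mono) (auto simp: not_le)
    then have "(p - 1) * (n * (p - 1) + n\<^sup>2) < (p - 1) * (\<Sum>t\<in>{0<..<p}. int (dilate_energy p A B t))"
      using p by (simp add: sum_distrib_left)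
    then show False
      using le p by simp
  qed
  then show ?thesis
    using that by auto
qed

text \<open>If the sumset had at most \<open>p / 2\<close> elements, Cauchy-Schwarz and the energy
  bound would give \<open>n * (p - 2) \<le> p * (p - 1)\<close>. With \<open>n \<ge> 2 * p\<close>
  this forces \<open>2 * (p - 2) \<le> p - 1\<close>, which fails for
  \<open>p \<ge> 5\<close>.\<close>

lemma dilate_sum_large:
  fixes p :: int
  assumes "p \<ge> 5" and "A \<subseteq> {0..<p}" and "B \<subseteq> {0..<p}"
  defines "n \<equiv> int (card A * card B)"
  assumes "n \<ge> 2 * p" and "(p - 1) * int (dilate_energy p A B t) \<le> n * (p - 1) + n\<^sup>2"
  shows "2 * int (card (dilate_sum p A B t)) > p"
proof (rule ccontr)
  define c where "c = int (card (dilate_sum p A B t))"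
  define e where "e = int (dilate_energy p A B t)"
  have fin: "finite (A \<times> B)"
    using assms(2,3) by (intro finite_cartesian_product) (auto intro: finite_subset)
  have "(card (A \<times> B))\<^sup>2 \<le> card (dilate_sum p A B t) * dilate_energy p A B t"
    using card_squared_le_image_times_collisions[OF fin, of "\<lambda>(a, b). (a + t * b) mod p"]
    by (simp add: dilate_sum_def dilate_energy_def case_prod_unfold)
  then have "int ((card (A \<times> B))\<^sup>2) \<le> int (card (dilate_sum p A B t) * dilate_energy p A B t)"
    by (simp only: of_nat_le_iff)
  then have ce: "n\<^sup>2 \<le> c * e"
    by (simp add: n_def c_def e_def card_cartesian_product)
  assume "\<not> ?thesis"
  then have "2 * c \<le> p"
    by (simp add: c_def)
  have "2 * n\<^sup>2 * (p - 1) \<le> 2 * (c * e) * (p - 1)"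
    using ce assms(1) by (intro mult_right_mono) auto
  also have "\<dots> = (2 * c) * ((p - 1) * e)"
    by (simp add: algebra_simps)
  also have "\<dots> \<le> p * (n * (p - 1) + n\<^sup>2)"
    using \<open>2 * c \<le> p\<close> assms(1,6) by (intro mult_mono) (auto simp: e_def)
  finally have "n * (2 * n * (p - 1)) \<le> n * (p * (p - 1) + p * n)"
    by (simp add: power2_eq_square algebra_simps)
  moreover have "n > 0"
    using assms(1,5) by linarith
  ultimately have "2 * n * (p - 1) \<le> p * (p - 1) + p * n"
    by simp
  then have "n * (p - 2) \<le> p * (p - 1)"
    by (simp add: algebra_simps)
  moreover have "2 * p * (p - 2) \<le> n * (p - 2)"
    using assms(1,5) by (intro mult_right_mono) auto
  ultimately have "p * (2 * (p - 2)) \<le> p * (p - 1)"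
    using \<open>n * (p - 2) \<le> p * (p - 1)\<close> by (simp only: mult.assoc mult.left_commute)
  then show False
    using assms(1) by simp
qed

text \<open>Applying the pigeonhole principle to \<open>A - tB\<close> writes \<open>t\<close> as \<open>(a\<^sub>1 + a\<^sub>2) / (b\<^sub>1 + b\<^sub>2)\<close>,
  so that \<open>(b\<^sub>1 + b\<^sub>2)(A + tB)\<close> consists of sums of four products without any minus signs.\<close>

lemma eightfold_sum_of_products:
  fixes p lam :: int
  assumes "prime p" and "p \<ge> 5" and "A \<subseteq> {0..<p}" and "B \<subseteq> {0..<p}"
    and "int (card A * card B) \<ge> 2 * p"
    and anti: "\<And>b b'. b \<in> B \<Longrightarrow> b' \<in> B \<Longrightarrow> \<not> p dvd b + b'"
  shows "\<exists>xs. length xs = 8 \<and> set xs \<subseteq> A \<times> B \<and> [(\<Sum>(a, b)\<leftarrow>xs. a * b) = lam] (mod p)"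
proof -
  obtain t where t: "(p - 1) * int (dilate_energy p A B t)
      \<le> int (card A * card B) * (p - 1) + (int (card A * card B))\<^sup>2"
    using exists_small_dilate_energy[OF assms(1,3,4)] by metis
  have sub: "dilate_sum p A B t \<subseteq> {0..<p}" for t
    using assms(2) by (auto simp: dilate_sum_def)
  have large: "2 * int (card (dilate_sum p A B t)) > p" "2 * int (card (dilate_sum p A B (- t))) > p"
    using dilate_sum_large[OF assms(2-5)] t by (simp_all add: dilate_energy_uminus)
  \<comment> \<open>Representing \<open>0\<close> as a sum of two elements of \<open>A - tB\<close>
    is what yields \<open>a1 + a2\<close> congruent to \<open>t * (b1 + b2)\<close>.\<close>
  obtain x y where xy: "x \<in> dilate_sum p A B (- t)" "y \<in> dilate_sum p A B (- t)" "[x + y = 0] (mod p)"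
    using sum_of_two_large_sets[OF _ sub large(2)] assms(2) by (metis less_le_trans zero_less_numeral)
  then obtain a1 b1 a2 b2 where ab: "a1 \<in> A" "b1 \<in> B" "a2 \<in> A" "b2 \<in> B"
    and "x = (a1 + - t * b1) mod p" "y = (a2 + - t * b2) mod p"
    by (auto simp: dilate_sum_def)
  then have "p dvd (a1 + - t * b1) + (a2 + - t * b2)"
    using xy(3) by (simp add: cong_def mod_simps mod_0_imp_dvd)
  then have t_eq: "p dvd (a1 + a2) - t * (b1 + b2)"
    by (simp add: algebra_simps)
  \<comment> \<open>Here the disjointness of \<open>B\<close> and \<open>-B\<close> enters:
    \<open>b1 + b2\<close> can be divided out, so it remains to represent \<open>mu\<close>, the
    quotient of \<open>lam\<close> by it, in \<open>A + tB\<close> twice.\<close>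
  have "coprime (b1 + b2) p"
    using anti[OF ab(2,4)] assms(1) by (simp add: coprime_commute prime_imp_coprime)
  then obtain mu where mu: "[(b1 + b2) * mu = lam] (mod p)"
    by (metis cong_solve_coprime_int cong_scalar_right mult.assoc mult_1)
  obtain x y where xy: "x \<in> dilate_sum p A B t" "y \<in> dilate_sum p A B t" "[x + y = mu] (mod p)"
    using sum_of_two_large_sets[OF _ sub large(1)] assms(2) by (metis less_le_trans zero_less_numeral)
  then obtain a3 b3 a4 b4 where ab': "a3 \<in> A" "b3 \<in> B" "a4 \<in> A" "b4 \<in> B"
    and "x = (a3 + t * b3) mod p" "y = (a4 + t * b4) mod p"
    by (auto simp: dilate_sum_def)
  then have mu': "[(a3 + t * b3) + (a4 + t * b4) = mu] (mod p)"
    using xy(3) by (simp add: cong_def mod_simps)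
  \<comment> \<open>The terms of \<open>(b1 + b2) * (a3 + a4) + (a1 + a2) * (b3 + b4)\<close>, where
    \<open>a1 + a2\<close> stands in for \<open>t * (b1 + b2)\<close>.\<close>
  let ?xs = "[(a3, b1), (a3, b2), (a4, b1), (a4, b2), (a1, b3), (a1, b4), (a2, b3), (a2, b4)]"
  have "(\<Sum>(a, b)\<leftarrow>?xs. a * b)
      = (b1 + b2) * ((a3 + t * b3) + (a4 + t * b4)) + ((a1 + a2) - t * (b1 + b2)) * (b3 + b4)"
    by (simp add: algebra_simps)
  also have "[\<dots> = (b1 + b2) * mu + 0 * (b3 + b4)] (mod p)"
    using mu' t_eq by (intro cong_add cong_mult cong_refl) (auto simp: cong_0_iff)
  also have "[(b1 + b2) * mu + 0 * (b3 + b4) = lam] (mod p)"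
    using mu by simp
  finally have "[(\<Sum>(a, b)\<leftarrow>?xs. a * b) = lam] (mod p)" .
  then show ?thesis
    using ab ab' by (intro exI[of _ ?xs]) simp
qed

subsection \<open>The divisor bound\<close>

text \<open>The map sending \<open>(i, d)\<close> to \<open>q ^ i * d\<close>, with
  \<open>i \<le> a\<close> and \<open>d\<close> dividing \<open>n\<close>, reaches every divisor of
  the product.\<close>

lemma card_divisors_prime_power_mult_le:
  fixes q a n :: nat
  assumes "prime q" and "n > 0"
  shows "card {d. d dvd q ^ a * n} \<le> (a + 1) * card {d. d dvd n}"
proof -
  have "{d. d dvd q ^ a * n} \<subseteq> (\<lambda>(i, d). q ^ i * d) ` ({..a} \<times> {d. d dvd n})"
  proof
    fix d
    assume "d \<in> {d. d dvd q ^ a * n}"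
    then obtain x y where "d = x * y" "x dvd q ^ a" "y dvd n"
      using division_decomp by blast
    then show "d \<in> (\<lambda>(i, d). q ^ i * d) ` ({..a} \<times> {d. d dvd n})"
      using assms(1) by (auto simp: divides_primepow_nat image_iff)
  qed
  then have "card {d. d dvd q ^ a * n} \<le> card ({..a} \<times> {d. d dvd n})"
    using assms(2) by (intro surj_card_le) auto
  then show ?thesis
    by (simp add: card_cartesian_product)
qed

text \<open>Prime powers are split off one at a time. The factor \<open>a + 1\<close> is at most
  \<open>(q ^ a) powr \<delta>\<close> if \<open>q powr \<delta> \<ge> 2\<close>, and at most
  \<open>K\<close> times that otherwise. The exceptional primes are bounded in terms of
  \<open>\<delta>\<close> alone, so the total loss is a constant.\<close>

lemma card_divisors_le_powr:
  fixes \<delta> :: real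
  assumes "\<delta> > 0"
  obtains C :: real where "C \<ge> 1" and "\<And>n::nat. n > 0 \<Longrightarrow> real (card {d. d dvd n}) \<le> C * real n powr \<delta>"
proof -
  \<comment> \<open>Chosen so that \<open>a \<le> K * \<delta> * a * ln 2\<close>; then
    \<open>1 + x \<le> exp x\<close> compares \<open>a + 1\<close> with
    \<open>(2 ^ a) powr \<delta>\<close>.\<close>
  define K where "K = max 1 (1 / (\<delta> * ln 2))"
  define S where "S n = {q. prime q \<and> real q powr \<delta> < 2 \<and> q dvd n}" for n :: nat
  have K: "K \<ge> 1" "1 \<le> K * (\<delta> * ln 2)"
    using assms by (auto simp: K_def max_def field_simps)
  have small: "real (a + 1) \<le> K * (real q ^ a) powr \<delta>" if "prime q" for q a :: nat
  proof -
    have "real a * 1 \<le> real a * (K * (\<delta> * ln 2))"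
      using K by (intro mult_left_mono) auto
    then have "real (a + 1) \<le> K * (1 + \<delta> * (real a * ln 2))"
      using K by (simp add: algebra_simps)
    also have "\<dots> \<le> K * exp (\<delta> * (real a * ln 2))"
      using K by (intro mult_left_mono exp_ge_add_one_self) auto
    also have "exp (\<delta> * (real a * ln 2)) = (2 ^ a) powr \<delta>"
      by (simp add: powr_def ln_realpow)
    also have "(2 ^ a) powr \<delta> \<le> (real q ^ a) powr \<delta>"
      using assms prime_ge_2_nat[OF that] by (intro powr_mono2 power_mono) auto
    finally show ?thesis
      using K by simp
  qed
  have large: "real (a + 1) \<le> (real q ^ a) powr \<delta>" if "real q powr \<delta> \<ge> 2" for q a :: nat
  proof -
    have "a + 1 \<le> 2 ^ a"
      by (simp add: Suc_leI)
    then have "real (a + 1) \<le> 2 ^ a"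
      by (metis of_nat_le_iff of_nat_numeral of_nat_power)
    also have "\<dots> \<le> (real q powr \<delta>) ^ a"
      using that by (intro power_mono) auto
    also have "\<dots> = (real q ^ a) powr \<delta>"
      using that by (cases "q = 0") (auto simp: powr_realpow [symmetric] powr_powr mult.commute)
    finally show ?thesis .
  qed
  have fin: "finite (S n)" if "n > 0" for n
    by (rule finite_subset[of _ "{d. d dvd n}"]) (use that in \<open>auto simp: S_def\<close>)
  have bound: "n > 0 \<Longrightarrow> real (card {d. d dvd n}) \<le> K ^ card (S n) * real n powr \<delta>" for n
  proof (induction n rule: less_induct)
    case (less n)
    show ?case
    proof (cases "n = 1")
      case True
      then have "S n = {}"
        by (auto simp: S_def)
      then show ?thesis
        using True by simp
    next
      case False
      then obtain q where q: "prime q" "q dvd n"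
        using prime_factor_nat by blast
      define a where "a = multiplicity q n"
      obtain m where n: "n = q ^ a * m" and "\<not> q dvd m"
        using multiplicity_decompose'[of n q] less.prems q(1) not_prime_unit
        by (metis a_def neq0_conv)
      have "m > 0"
        using less.prems n by (cases m) auto
      have "a > 0"
        using q less.prems by (simp add: a_def prime_multiplicity_gt_zero_iff)
      then have "q ^ a > 1"
        using q(1) by (intro one_less_power prime_gt_1_nat)
      then have "m < n"
        using \<open>m > 0\<close> by (simp add: n)
      have IH: "real (card {d. d dvd m}) \<le> K ^ card (S m) * real m powr \<delta>"
        using less.IH[OF \<open>m < n\<close> \<open>m > 0\<close>] .
      have sub: "S m \<subseteq> S n" and notin: "q \<notin> S m"
        using \<open>\<not> q dvd m\<close> by (auto simp: S_def n)
      have *: "real (a + 1) * K ^ card (S m) \<le> K ^ card (S n) * (real q ^ a) powr \<delta>"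
      proof (cases "real q powr \<delta> < 2")
        case True
        then have "insert q (S m) \<subseteq> S n"
          using sub q by (auto simp: S_def)
        then have "Suc (card (S m)) \<le> card (S n)"
          using card_mono[OF fin[OF less.prems], of "insert q (S m)"] notin fin[OF \<open>m > 0\<close>] by simp
        then have "K ^ Suc (card (S m)) \<le> K ^ card (S n)"
          using K by (intro power_increasing) auto
        then have "K ^ Suc (card (S m)) * (real q ^ a) powr \<delta> \<le> K ^ card (S n) * (real q ^ a) powr \<delta>"
          by (intro mult_right_mono) auto
        moreover have "real (a + 1) * K ^ card (S m) \<le> (K * (real q ^ a) powr \<delta>) * K ^ card (S m)"
          using small[OF q(1)] K by (intro mult_right_mono) auto
        ultimately show ?thesis
          by (simp add: algebra_simps)
      next
        case False
        have "K ^ card (S m) \<le> K ^ card (S n)"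
          using K sub fin[OF less.prems] by (intro power_increasing card_mono) auto
        then have "real (a + 1) * K ^ card (S m) \<le> (real q ^ a) powr \<delta> * K ^ card (S n)"
          using large[of q a] False K by (intro mult_mono) auto
        then show ?thesis
          by (simp add: mult.commute)
      qed
      have "real (card {d. d dvd n}) \<le> real ((a + 1) * card {d. d dvd m})"
        using card_divisors_prime_power_mult_le[OF q(1) \<open>m > 0\<close>] n by (simp only: of_nat_le_iff)
      also have "\<dots> \<le> real (a + 1) * (K ^ card (S m) * real m powr \<delta>)"
        using IH unfolding of_nat_mult by (intro mult_left_mono) auto
      also have "\<dots> \<le> (K ^ card (S n) * (real q ^ a) powr \<delta>) * real m powr \<delta>"
        using * unfolding mult.assoc[symmetric] by (intro mult_right_mono) auto
      also have "\<dots> = K ^ card (S n) * real n powr \<delta>"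
        by (simp add: n powr_mult)
      finally show ?thesis .
    qed
  qed
  \<comment> \<open>Primes with \<open>q powr \<delta> < 2\<close> lie below
    \<open>2 powr (1 / \<delta>)\<close>, so \<open>K ^ (R + 1)\<close> bounds the loss uniformly in
    \<open>n\<close>.\<close>
  define R where "R = nat \<lceil>2 powr (1 / \<delta>)\<rceil>"
  have "S n \<subseteq> {..R}" for n
  proof
    fix q
    assume "q \<in> S n"
    then have "real q powr \<delta> < 2" "q > 0"
      by (auto simp: S_def prime_gt_0_nat)
    then have "(real q powr \<delta>) powr (1 / \<delta>) \<le> 2 powr (1 / \<delta>)"
      using assms by (intro powr_mono2) auto
    then show "q \<in> {..R}"
      using assms \<open>q > 0\<close> unfolding R_def by (simp add: powr_powr) linarith
  qed
  then have "card (S n) \<le> card {..R}" for n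
    by (intro card_mono) auto
  then have "K ^ card (S n) \<le> K ^ (R + 1)" for n
    using K by (intro power_increasing) auto
  then have "K ^ card (S n) * real n powr \<delta> \<le> K ^ (R + 1) * real n powr \<delta>" for n
    by (intro mult_right_mono) auto
  then show ?thesis
    using that[of "K ^ (R + 1)"] bound K by (meson one_le_power order_trans)
qed

section \<open>Factorizations of nonzero integers\<close>

lemma factorizations_subset:
  fixes Z :: int
  assumes "Z \<noteq> 0"
  shows "{(x, y). x * y = Z} \<subseteq>
    (\<lambda>(s, d). (s * int d, Z div (s * int d))) ` ({1, -1} \<times> {d. d dvd nat \<bar>Z\<bar>})"
proof clarify
  fix x y
  assume Z: "Z = x * y"
  then have "x \<noteq> 0" "nat \<bar>x\<bar> dvd nat \<bar>Z\<bar>"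
    using assms by (auto simp: abs_mult nat_mult_distrib)
  then have "(sgn x, nat \<bar>x\<bar>) \<in> {1, -1} \<times> {d. d dvd nat \<bar>Z\<bar>}"
    by (simp add: sgn_if)
  moreover have "(x, y) = (\<lambda>(s, d). (s * int d, Z div (s * int d))) (sgn x, nat \<bar>x\<bar>)"
    using \<open>x \<noteq> 0\<close> Z by (simp add: sgn_mult_abs)
  ultimately show "(x, y) \<in> (\<lambda>(s, d). (s * int d, x * y div (s * int d))) `
      ({1, -1} \<times> {d. d dvd nat \<bar>x * y\<bar>})"
    unfolding Z by (rule rev_image_eqI)
qed

lemma finite_factorizations:
  fixes Z :: int
  assumes "Z \<noteq> 0"
  shows "finite {(x, y). x * y = Z}"
  by (rule finite_subset[OF factorizations_subset[OF assms]],
      intro finite_imageI finite_cartesian_product finite_divisors_nat) (use assms in auto)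

text \<open>The first factor determines the second and is itself given by a sign and a divisor of
  \<open>\<bar>Z\<bar>\<close>; the sign accounts for the factor 2.\<close>

lemma card_factorizations_le:
  fixes Z :: int
  assumes "Z \<noteq> 0"
  shows "card {(x, y). x * y = Z} \<le> 2 * card {d. d dvd nat \<bar>Z\<bar>}"
proof -
  have "card {(x, y). x * y = Z} \<le> card ({1, -1::int} \<times> {d. d dvd nat \<bar>Z\<bar>})"
    by (rule surj_card_le[OF _ factorizations_subset[OF assms]],
        intro finite_cartesian_product finite_divisors_nat) (use assms in auto)
  then show ?thesis
    by (simp add: card_cartesian_product)
qed

subsection \<open>Lattice points at two scales\<close>

text \<open>The vectors of a planar lattice in a square box. The origin is left out so that a
  shortest element is a nonzero vector.\<close>

definition lattice_points :: "int \<Rightarrow> int \<Rightarrow> int \<Rightarrow> int \<Rightarrow> (int \<times> int) set" where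
  "lattice_points p a b Q =
     {(z, w). (z, w) \<noteq> (0, 0) \<and> \<bar>z\<bar> \<le> Q \<and> \<bar>w\<bar> \<le> Q \<and> p dvd z * a - w * b}"

lemma finite_lattice_points [simp]: "finite (lattice_points p a b Q)"
  by (rule finite_subset[of _ "{-Q..Q} \<times> {-Q..Q}"]) (auto simp: lattice_points_def)

lemma card_lattice_points_swap: "card (lattice_points p a b Q) = card (lattice_points p b a Q)"
  by (rule bij_betw_same_card[of prod.swap], rule bij_betwI[of _ _ _ prod.swap])
     (auto simp: lattice_points_def dvd_diff_commute)

text \<open>The lattice is covered by lines parallel to its shortest vector: the cross product with that
  vector is a multiple of \<open>p\<close> and numbers the lines, and on each line the points are spaced.\<close>

lemma card_lattice_points_le_shortest:
  fixes p a b Q z0 w0 :: int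
  assumes "p > 0" and "coprime a p"
    and v: "(z0, w0) \<in> lattice_points p a b Q" and "\<bar>z0\<bar> \<le> \<bar>w0\<bar>"
    and shortest: "\<And>z w. (z, w) \<in> lattice_points p a b Q \<Longrightarrow> \<bar>w0\<bar> \<le> max \<bar>z\<bar> \<bar>w\<bar>"
  shows "int (card (lattice_points p a b Q))
    \<le> (2 * (2 * Q * \<bar>w0\<bar> div p) + 1) * (2 * (Q div \<bar>w0\<bar>) + 2)"
proof -
  define h where "h = \<bar>w0\<bar>"
  have h: "h > 0" "h \<le> Q" "\<bar>z0\<bar> \<le> h"
    using v assms(4) by (auto simp: lattice_points_def h_def)
  \<comment> \<open>The first coordinate numbers the line through the point, the second the block of
    length \<open>h\<close> that contains \<open>w\<close>.\<close>
  define f where "f = (\<lambda>(z, w). ((z * w0 - w * z0) div p, w div h))"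
  have cross: "p dvd z * w0 - w * z0" if "(z, w) \<in> lattice_points p a b Q" for z w
  proof -
    have "p dvd z * a - w * b" "p dvd z0 * a - w0 * b"
      using that v by (auto simp: lattice_points_def)
    then have "p dvd w0 * (z * a - w * b) - w * (z0 * a - w0 * b)"
      by (metis dvd_diff dvd_mult)
    then have "p dvd (z * w0 - w * z0) * a"
      by (simp add: algebra_simps)
    then show ?thesis
      using assms(2) by (simp add: coprime_commute coprime_dvd_mult_left_iff)
  qed
  \<comment> \<open>Two points on one line and in one block differ by a lattice vector of sup norm
    below \<open>h\<close>; by minimality of \<open>h\<close> it is zero.\<close>
  have "inj_on f (lattice_points p a b Q)"
  proof (rule inj_onI, clarify)
    fix z w z' w'
    assume zw: "(z, w) \<in> lattice_points p a b Q" "(z', w') \<in> lattice_points p a b Q"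
      and "f (z, w) = f (z', w')"
    then have "(z * w0 - w * z0) div p = (z' * w0 - w' * z0) div p" and div: "w div h = w' div h"
      by (simp_all add: f_def)
    then have eq: "z * w0 - w * z0 = z' * w0 - w' * z0"
      using dvd_div_eq_cancel cross zw by blast
    have "h * (w div h) + w mod h = w"
      by (rule mult_div_mod_eq)
    moreover have "h * (w div h) + w' mod h = w'"
      unfolding div by (rule mult_div_mod_eq)
    ultimately have "\<bar>w - w'\<bar> < h"
      using pos_mod_bound[OF h(1), of w] pos_mod_bound[OF h(1), of w']
        pos_mod_sign[OF h(1), of w] pos_mod_sign[OF h(1), of w'] by linarith
    have "\<bar>z - z'\<bar> * h = \<bar>(z - z') * w0\<bar>"
      by (simp add: abs_mult h_def)
    also have "(z - z') * w0 = (w - w') * z0"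
      using eq by (simp add: algebra_simps)
    also have "\<bar>(w - w') * z0\<bar> \<le> \<bar>w - w'\<bar> * h"
      using h(3) by (simp add: abs_mult mult_left_mono)
    finally have "\<bar>z - z'\<bar> \<le> \<bar>w - w'\<bar>"
      using h(1) by simp
    show "z = z' \<and> w = w'"
    proof (rule ccontr)
      assume "\<not> (z = z' \<and> w = w')"
      moreover have "p dvd z * a - w * b" "p dvd z' * a - w' * b"
        using zw by (auto simp: lattice_points_def)
      then have "p dvd (z * a - w * b) - (z' * a - w' * b)"
        by (rule dvd_diff)
      ultimately have "(z - z', w - w') \<in> lattice_points p a b Q"
        using \<open>\<bar>z - z'\<bar> \<le> \<bar>w - w'\<bar>\<close> \<open>\<bar>w - w'\<bar> < h\<close> h(2)
        by (auto simp: lattice_points_def algebra_simps)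
      then show False
        using shortest \<open>\<bar>z - z'\<bar> \<le> \<bar>w - w'\<bar>\<close> \<open>\<bar>w - w'\<bar> < h\<close> h_def by force
    qed
  qed
  \<comment> \<open>The cross product is at most \<open>2 * Q * h\<close> in absolute value. The
    block range begins one below \<open>- (Q div h)\<close> because division rounds
    \<open>- Q\<close> downwards.\<close>
  moreover have "f ` lattice_points p a b Q
      \<subseteq> {- (2 * Q * h div p)..2 * Q * h div p} \<times> {- (Q div h) - 1..Q div h}"
  proof (rule image_subsetI)
    fix x
    assume "x \<in> lattice_points p a b Q"
    then obtain z w where x: "x = (z, w)" and zw: "(z, w) \<in> lattice_points p a b Q"
      by (cases x) auto
    define k where "k = (z * w0 - w * z0) div p"
    have k: "p * k = z * w0 - w * z0"
      using cross[OF zw] by (simp add: k_def)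
    have "\<bar>p * k\<bar> \<le> \<bar>z\<bar> * \<bar>w0\<bar> + \<bar>w\<bar> * \<bar>z0\<bar>"
      unfolding k abs_mult[symmetric] by (rule abs_triangle_ineq4)
    also have "\<dots> \<le> Q * h + Q * h"
      using zw h by (intro add_mono mult_mono) (auto simp: lattice_points_def h_def)
    finally have "\<bar>k\<bar> * p \<le> 2 * Q * h"
      using assms(1) by (simp add: abs_mult algebra_simps)
    then have "\<bar>k\<bar> \<le> 2 * Q * h div p"
      using assms(1) zdiv_mono1[of "\<bar>k\<bar> * p" "2 * Q * h" p] by simp
    moreover have "- Q \<le> w" "w \<le> Q"
      using zw by (auto simp: lattice_points_def)
    then have "(- Q) div h \<le> w div h" "w div h \<le> Q div h"
      using h(1) by (auto intro: zdiv_mono1)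
    moreover have "- (Q div h) - 1 \<le> (- Q) div h"
      using h(1) by (simp add: zdiv_zminus1_eq_if)
    ultimately show "f x \<in> {- (2 * Q * h div p)..2 * Q * h div p} \<times> {- (Q div h) - 1..Q div h}"
      by (auto simp: f_def x k_def)
  qed
  ultimately have "card (lattice_points p a b Q)
      \<le> card ({- (2 * Q * h div p)..2 * Q * h div p} \<times> {- (Q div h) - 1..Q div h})"
    by (intro card_inj_on_le) auto
  also have "int \<dots> = (2 * (2 * Q * h div p) + 1) * (2 * (Q div h) + 2)"
    using h assms(1) by (simp add: card_cartesian_product pos_imp_zdiv_nonneg_iff)
  finally show ?thesis
    by (simp add: h_def)
qed

text \<open>The positive multiples of a single short vector already supply this many points of the
  box.\<close>

lemma multiples_in_lattice_points:
  fixes p a b z0 w0 n :: int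
  assumes "p dvd z0 * a - w0 * b" and "w0 \<noteq> 0" and "\<bar>z0\<bar> \<le> \<bar>w0\<bar>"
  shows "n div \<bar>w0\<bar> \<le> int (card (lattice_points p a b n))"
proof -
  have "(\<lambda>j. (j * z0, j * w0)) ` {1..n div \<bar>w0\<bar>} \<subseteq> lattice_points p a b n"
  proof clarify
    fix j
    assume j: "j \<in> {1..n div \<bar>w0\<bar>}"
    have "j * \<bar>w0\<bar> \<le> (n div \<bar>w0\<bar>) * \<bar>w0\<bar>"
      using j by (intro mult_right_mono) auto
    also have "\<dots> \<le> n"
      using assms(2) by (metis div_mult_mod_eq le_add_same_cancel1 pos_mod_sign zero_less_abs_iff)
    finally have w: "\<bar>j * w0\<bar> \<le> n"
      using j by (simp add: abs_mult)
    have "\<bar>j * z0\<bar> \<le> \<bar>j * w0\<bar>"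
      using assms(3) by (simp add: abs_mult mult_left_mono)
    moreover have "p dvd j * (z0 * a - w0 * b)"
      using assms(1) by simp
    ultimately show "(j * z0, j * w0) \<in> lattice_points p a b n"
      using w j assms(2) by (auto simp: lattice_points_def algebra_simps)
  qed
  then have "card {1..n div \<bar>w0\<bar>} \<le> card (lattice_points p a b n)"
    using assms(2) by (intro card_inj_on_le[of "\<lambda>j. (j * z0, j * w0)"]) (auto simp: inj_on_def)
  then show ?thesis
    by simp
qed

text \<open>Let \<open>h\<close> be the sup norm of a shortest vector in the larger box. Covering by
  lines gives \<open>16 * Q\<^sup>2 / p + 4 * Q / h\<close>. If \<open>h > n\<close>, then
  \<open>Q / h\<close> is below \<open>Q / n\<close>; if \<open>h \<le> n\<close>, the multiples of
  the shortest vector show that \<open>n / h\<close> is at most twice the count in the smaller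
  box.\<close>

lemma card_lattice_points_rescale:
  fixes p a b Q n :: int
  assumes "p > 0" and "coprime a p" and "coprime b p" and "1 \<le> n" and "n \<le> Q"
  shows "real (card (lattice_points p a b Q))
    \<le> 16 * real_of_int Q ^ 2 / p + 4 * real_of_int Q / n + 8 * (Q / n) * card (lattice_points p a b n)"
proof (cases "lattice_points p a b Q = {}")
  case True
  then show ?thesis
    using assms by simp
next
  case False
  have oriented: "real (card (lattice_points p a b Q))
    \<le> 16 * real_of_int Q ^ 2 / p + 4 * real_of_int Q / n + 8 * (Q / n) * card (lattice_points p a b n)"
    if "coprime a p" and v: "(z0, w0) \<in> lattice_points p a b Q" and "\<bar>z0\<bar> \<le> \<bar>w0\<bar>"
    and "\<And>z w. (z, w) \<in> lattice_points p a b Q \<Longrightarrow> \<bar>w0\<bar> \<le> max \<bar>z\<bar> \<bar>w\<bar>"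
    for a b z0 w0
  proof -
    define h where "h = \<bar>w0\<bar>"
    define c where "c = real (card (lattice_points p a b n))"
    have h: "h > 0" "h \<le> Q" "w0 \<noteq> 0"
      using v that(3) by (auto simp: lattice_points_def h_def)
    have hpos: "0 < real_of_int h" "real_of_int h \<le> real_of_int Q" "0 < real_of_int Q" "0 < real_of_int n"
      using h(1,2) assms by linarith+
    have ppos: "0 < real_of_int p"
      using assms(1) by simp
    have "real (card (lattice_points p a b Q))
        \<le> real_of_int ((2 * (2 * Q * h div p) + 1) * (2 * (Q div h) + 2))"
      using card_lattice_points_le_shortest[OF assms(1) that] unfolding h_def by linarith
    also have "\<dots> = (2 * real_of_int (2 * Q * h div p) + 1) * (2 * real_of_int (Q div h) + 2)"
      by simp
    also have "\<dots> \<le> (2 * (2 * Q * h / p) + 1) * (2 * (Q / h) + 2 * (Q / h))"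
    proof (intro mult_mono add_mono mult_left_mono)
      show "real_of_int (2 * Q * h div p) \<le> 2 * Q * h / p"
        using real_of_int_div4[of "2 * Q * h" p] by simp
      show "real_of_int (Q div h) \<le> Q / h"
        by (rule real_of_int_div4)
      show "2 \<le> 2 * (real_of_int Q / h)"
        using hpos by (simp add: field_simps)
    qed (use hpos ppos h(1,2) in \<open>auto simp: pos_imp_zdiv_nonneg_iff\<close>)
    also have "\<dots> = 16 * real_of_int Q ^ 2 / p + 4 * (Q / h)"
      using hpos ppos by (simp add: field_simps power2_eq_square)
    also have "Q / h \<le> Q / n + 2 * (Q / n) * c"
    proof (cases "h \<le> n")
      case True
      have "n div h \<le> int (card (lattice_points p a b n))"
        unfolding h_def using v h(3) that(3)
        by (intro multiples_in_lattice_points) (auto simp: lattice_points_def)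
      then have c: "real_of_int (n div h) \<le> c"
        unfolding c_def by linarith
      \<comment> \<open>Since the floor is at least 1, \<open>n / h\<close> is at most its
        double.\<close>
      have "1 \<le> n div h"
        using True h(1) by (simp add: pos_imp_zdiv_pos_iff int_one_le_iff_zero_less)
      then have "1 \<le> real_of_int (n div h)"
        by simp
      moreover have "real_of_int n / h \<le> real_of_int (n div h) + 1"
        using real_of_int_div3[of n h] by linarith
      ultimately have "n / h \<le> 2 * c"
        using c by linarith
      then have "(Q / n) * (n / h) \<le> (Q / n) * (2 * c)"
        using hpos by (intro mult_left_mono) auto
      moreover have "x * (2 * c) \<le> x + 2 * x * c" if "0 \<le> x" for x
        using that by simp
      then have "(Q / n) * (2 * c) \<le> Q / n + 2 * (Q / n) * c"
        by this (use hpos in simp)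
      ultimately have "(Q / n) * (n / h) \<le> Q / n + 2 * (Q / n) * c"
        by (rule order_trans)
      moreover have "(Q / n) * (n / h) = Q / h"
        using hpos by simp
      ultimately show ?thesis
        by (simp only:)
    next
      case False
      then have "Q / h \<le> Q / n"
        using hpos by (intro divide_left_mono) auto
      moreover have "0 \<le> 2 * (Q / n) * c"
        using hpos by (simp add: c_def)
      ultimately show ?thesis
        by linarith
    qed
    finally show ?thesis
      unfolding c_def by (simp add: algebra_simps)
  qed
  define norm where "norm = (\<lambda>(z, w). max \<bar>z\<bar> \<bar>w :: int\<bar>)"
  obtain z0 w0 where v: "(z0, w0) \<in> lattice_points p a b Q"
    and min: "\<And>z w. (z, w) \<in> lattice_points p a b Q \<Longrightarrow> norm (z0, w0) \<le> norm (z, w)"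
    using arg_min_if_finite[OF finite_lattice_points False, of norm]
    by (metis linorder_not_le surj_pair)
  show ?thesis
  proof (cases "\<bar>z0\<bar> \<le> \<bar>w0\<bar>")
    case True
    then show ?thesis
      using oriented[OF assms(2) v] min by (simp add: norm_def)
  next
    case False
    \<comment> \<open>The block \<open>oriented\<close> expects the second coordinate to dominate;
      the other case reduces to it by exchanging the coordinates together with \<open>a\<close> and
      \<open>b\<close>.\<close>
    have "(w0, z0) \<in> lattice_points p b a Q"
      using v by (auto simp: lattice_points_def dvd_diff_commute)
    moreover have "\<bar>z0\<bar> \<le> max \<bar>z\<bar> \<bar>w\<bar>" if "(z, w) \<in> lattice_points p b a Q" for z w
      using min[of w z] that False by (auto simp: norm_def lattice_points_def dvd_diff_commute max_def split: if_splits)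
    ultimately show ?thesis
      using oriented[OF assms(3)] False
      by (simp add: card_lattice_points_swap[of p a b])
  qed
qed

subsection \<open>Collisions between dilates of an interval by powers\<close>

text \<open>The counts \<open>J(m)\<close> and \<open>J(m\<^sup>2)\<close> of the outline are the
  cardinalities for \<open>Q = m\<close> and \<open>Q = m\<^sup>2\<close>, without the trivial
  solutions \<open>z = w = 0\<close>. The range of the exponents stays \<open>{1..m}\<close> in
  both.\<close>

definition power_collisions :: "int \<Rightarrow> int \<Rightarrow> nat \<Rightarrow> int \<Rightarrow> (nat \<times> nat \<times> int \<times> int) set" where
  "power_collisions p g m Q =
     (SIGMA k:{1..m}. SIGMA l:{1..m}. lattice_points p (g ^ k) (g ^ l) Q)"

lemma finite_power_collisions [simp]: "finite (power_collisions p g m Q)"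
  by (simp add: power_collisions_def)

lemma card_power_collisions:
  "card (power_collisions p g m Q) = (\<Sum>k=1..m. \<Sum>l=1..m. card (lattice_points p (g ^ k) (g ^ l) Q))"
  by (simp add: power_collisions_def card_SigmaI)

text \<open>As \<open>a\<close> and \<open>b\<close> are invertible, \<open>p\<close> divides
  \<open>z\<close> exactly when it divides \<open>w\<close>; in a box smaller than \<open>p\<close>
  both would then vanish.\<close>

lemma lattice_points_not_dvd:
  fixes p a b Q z w :: int
  assumes "coprime a p" and "coprime b p" and "Q < p" and zw: "(z, w) \<in> lattice_points p a b Q"
  shows "\<not> p dvd z" and "\<not> p dvd w"
proof -
  have dvd: "p dvd z * a - w * b" and bd: "\<bar>z\<bar> < p" "\<bar>w\<bar> < p" and nz: "z \<noteq> 0 \<or> w \<noteq> 0"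
    using zw assms(3) by (auto simp: lattice_points_def)
  have "p dvd z \<longleftrightarrow> p dvd z * a"
    using assms(1) by (simp add: coprime_commute coprime_dvd_mult_left_iff)
  also have "\<dots> \<longleftrightarrow> p dvd w * b"
    using dvd by (metis diff_add_cancel dvd_add_right_iff)
  also have "\<dots> \<longleftrightarrow> p dvd w"
    using assms(2) by (simp add: coprime_commute coprime_dvd_mult_left_iff)
  finally have iff: "p dvd z \<longleftrightarrow> p dvd w" .
  have "z = 0" if "p dvd z"
    using bd(1) that by (meson dvd_imp_le_int linorder_not_le abs_of_nonneg abs_ge_self order_less_le_trans)
  moreover have "w = 0" if "p dvd w"
    using bd(2) that by (meson dvd_imp_le_int linorder_not_le abs_of_nonneg abs_ge_self order_less_le_trans)
  ultimately show "\<not> p dvd z" "\<not> p dvd w"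
    using iff nz by auto
qed

text \<open>Cauchy-Schwarz over the common exponent \<open>k\<close>: two solutions of \<open>z g\<^sup>k \<equiv> w g\<^sup>l\<close> with the same
  \<open>k\<close> multiply to a solution for products, at the cost of the divisor function.\<close>

lemma card_power_collisions_squared_le:
  fixes p g :: int and m :: nat and D :: real
  assumes "prime p" and "coprime g p" and "int m < p" and "D \<ge> 0"
    and inj: "\<And>k l. k \<in> {1..m} \<Longrightarrow> l \<in> {1..m} \<Longrightarrow> [g ^ k = g ^ l] (mod p) \<Longrightarrow> k = l"
    and D: "\<And>Z. Z \<noteq> 0 \<Longrightarrow> \<bar>Z\<bar> \<le> (int m)\<^sup>2 \<Longrightarrow> real (card {(x, y). x * y = Z}) \<le> D"
  shows "(real (card (power_collisions p g m (int m))))\<^sup>2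
    \<le> real m * (D\<^sup>2 * card (power_collisions p g m ((int m)\<^sup>2)))"
proof -
  define S where "S = power_collisions p g m (int m)"
  define C where "C = {(s, t) \<in> S \<times> S. fst s = fst t}"
  define R where "R = power_collisions p g m ((int m)\<^sup>2)"
  \<comment> \<open>Multiplying \<open>z g\<^sup>k \<equiv> w g\<^sup>l\<close> by \<open>z'\<close>
    and using the second solution eliminates \<open>k\<close> and leaves
    \<open>(z w') g\<^sup>l\<^sup>' \<equiv> (z' w) g\<^sup>l\<close>.\<close>
  define \<Phi> :: "(nat \<times> nat \<times> int \<times> int) \<times> (nat \<times> nat \<times> int \<times> int) \<Rightarrow> nat \<times> nat \<times> int \<times> int"
    where "\<Phi> = (\<lambda>((k, l, z, w), (k', l', z', w')). (l', l, z * w', z' * w))"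
  have finS: "finite S"
    by (simp add: S_def)
  then have finC: "finite C"
    by (intro finite_subset[of C "S \<times> S"]) (auto simp: C_def)
  have cop: "coprime (g ^ k) p" for k
    using assms(2) by simp
  have ndvd: "\<not> p dvd z" "\<not> p dvd w" if "(k, l, z, w) \<in> S" for k l z w
    using that lattice_points_not_dvd[OF cop cop assms(3), of z w k l]
    by (auto simp: S_def power_collisions_def)
  have nonzero: "z * w' \<noteq> 0" if "(k, l, z, w) \<in> S" "(k', l', z', w') \<in> S" for k l z w k' l' z' w'
    using ndvd[OF that(1)] ndvd[OF that(2)] by auto
  have in_R: "(l', l, z * w', z' * w) \<in> R" if "(k, l, z, w) \<in> S" "(k, l', z', w') \<in> S"
    for k l z w l' z' w'
  proof -
    have bd: "\<bar>z\<bar> \<le> int m" "\<bar>w\<bar> \<le> int m" "\<bar>z'\<bar> \<le> int m" "\<bar>w'\<bar> \<le> int m"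
      and kl: "l \<in> {1..m}" "l' \<in> {1..m}"
      and dvd: "p dvd z * g ^ k - w * g ^ l" "p dvd z' * g ^ k - w' * g ^ l'"
      using that by (auto simp: S_def power_collisions_def lattice_points_def)
    have "p dvd z' * (z * g ^ k - w * g ^ l) - z * (z' * g ^ k - w' * g ^ l')"
      using dvd by (metis dvd_diff dvd_mult)
    then have "p dvd (z * w') * g ^ l' - (z' * w) * g ^ l"
      by (simp add: algebra_simps)
    moreover have "\<bar>z * w'\<bar> \<le> (int m)\<^sup>2" "\<bar>z' * w\<bar> \<le> (int m)\<^sup>2"
      using bd by (simp_all add: abs_mult power2_eq_square mult_mono)
    ultimately show ?thesis
      using kl nonzero[OF that] by (auto simp: R_def power_collisions_def lattice_points_def)
  qed
  have "fst ` S \<subseteq> {1..m}"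
    by (auto simp: S_def power_collisions_def)
  then have cm: "card (fst ` S) \<le> m"
    using card_mono[of "{1..m}" "fst ` S"] by simp
  have "(card S)\<^sup>2 \<le> card (fst ` S) * card C"
    unfolding C_def by (rule card_squared_le_image_times_collisions[OF finS])
  also have "\<dots> \<le> m * card C"
    using cm by simp
  finally have 1: "(real (card S))\<^sup>2 \<le> m * real (card C)"
    unfolding of_nat_mult[symmetric] of_nat_power[symmetric] of_nat_le_iff .
  have "real (card C) \<le> D\<^sup>2 * real (card R)"
  proof (rule card_le_image_times_fiber[OF finC])
    show "finite R"
      by (simp add: R_def)
    show "\<Phi> ` C \<subseteq> R"
      using in_R by (auto simp: C_def \<Phi>_def)
    fix r
    assume "r \<in> R"
    obtain l' l Z W where r: "r = (l', l, Z, W)"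
      by (cases r) auto
    define fib where "fib = {s \<in> C. \<Phi> s = r}"
    show "real (card {s \<in> C. \<Phi> s = r}) \<le> D\<^sup>2"
    proof (cases "fib = {}")
      case True
      then show ?thesis
        unfolding fib_def[symmetric] by simp
    next
      case False
      then obtain k0 z0 w0 z0' w0' where s0: "(k0, l, z0, w0) \<in> S" "(k0, l', z0', w0') \<in> S"
        and ZW: "Z = z0 * w0'" "W = z0' * w0"
        by (auto simp: fib_def C_def \<Phi>_def r)
      have Z: "Z \<noteq> 0" "\<bar>Z\<bar> \<le> (int m)\<^sup>2" and W: "W \<noteq> 0" "\<bar>W\<bar> \<le> (int m)\<^sup>2"
        using nonzero[OF s0] nonzero[OF s0(2,1)] in_R[OF s0] ZW
        by (auto simp: R_def power_collisions_def lattice_points_def)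
      define \<Psi> :: "(nat \<times> nat \<times> int \<times> int) \<times> (nat \<times> nat \<times> int \<times> int) \<Rightarrow> (int \<times> int) \<times> (int \<times> int)"
        where "\<Psi> = (\<lambda>((k, l, z, w), (k', l', z', w')). ((z, w'), (z', w)))"
      \<comment> \<open>On a fibre \<open>l\<close> and \<open>l'\<close> are fixed, and the four
        factors determine \<open>k\<close>: \<open>z\<close> is invertible, so \<open>g ^ k\<close>
        is known modulo \<open>p\<close>. Only the factorizations of \<open>Z\<close> and of
        \<open>W\<close> remain to be counted.\<close>
      have "inj_on \<Psi> fib"
      proof (rule inj_onI)
        fix c d
        assume cd: "c \<in> fib" "d \<in> fib" "\<Psi> c = \<Psi> d"
        obtain k1 z w z' w' where c: "c = ((k1, l, z, w), (k1, l', z', w'))" "(k1, l, z, w) \<in> S"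
          using cd(1) by (auto simp: fib_def C_def \<Phi>_def r)
        obtain k2 where d: "d = ((k2, l, z, w), (k2, l', z', w'))" "(k2, l, z, w) \<in> S"
          using cd(2,3) c by (auto simp: fib_def C_def \<Phi>_def \<Psi>_def r)
        have k: "k1 \<in> {1..m}" "k2 \<in> {1..m}" "p dvd z * g ^ k1 - w * g ^ l" "p dvd z * g ^ k2 - w * g ^ l"
          using c(2) d(2) by (auto simp: S_def power_collisions_def lattice_points_def)
        have "p dvd (z * g ^ k1 - w * g ^ l) - (z * g ^ k2 - w * g ^ l)"
          using k(3,4) by (rule dvd_diff)
        then have "p dvd z * (g ^ k1 - g ^ k2)"
          by (simp add: algebra_simps)
        then have "[g ^ k1 = g ^ k2] (mod p)"
          using ndvd[OF c(2)] assms(1) by (simp add: prime_dvd_mult_iff cong_iff_dvd_diff)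
        then show "c = d"
          using inj k(1,2) c d by simp
      qed
      moreover have "\<Psi> ` fib \<subseteq> {(x, y). x * y = Z} \<times> {(x, y). x * y = W}"
        by (auto simp: fib_def \<Phi>_def \<Psi>_def r)
      moreover have "finite ({(x, y). x * y = Z} \<times> {(x, y). x * y = W})"
        using Z(1) W(1) by (intro finite_cartesian_product finite_factorizations)
      ultimately have "card fib \<le> card ({(x, y). x * y = Z} \<times> {(x, y). x * y = W})"
        by (rule card_inj_on_le)
      then have "real (card fib) \<le> real (card {(x, y). x * y = Z}) * real (card {(x, y). x * y = W})"
        unfolding of_nat_mult[symmetric] card_cartesian_product[symmetric] of_nat_le_iff .
      also have "\<dots> \<le> D * D"
        using D[OF Z] D[OF W] assms(4) by (intro mult_mono) auto
      finally show ?thesis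
        by (simp add: fib_def power2_eq_square)
    qed
  qed
  then have "m * real (card C) \<le> real m * (D\<^sup>2 * real (card R))"
    by (intro mult_left_mono) auto
  then show ?thesis
    using 1 by (simp add: S_def R_def)
qed

text \<open>The comparison of the boxes of sizes \<open>m\<close> and \<open>m\<^sup>2\<close>,
  summed over all \<open>m\<^sup>2\<close> pairs of exponents.\<close>

lemma card_power_collisions_rescale:
  fixes p g :: int and m :: nat
  assumes "p > 0" and "coprime g p" and "m \<ge> 1"
  shows "real (card (power_collisions p g m ((int m)\<^sup>2)))
    \<le> 16 * real m ^ 6 / p + 4 * real m ^ 3 + 8 * real m * card (power_collisions p g m (int m))"
proof -
  define c where "c = 16 * real m ^ 4 / p + 4 * real m"
  have "real (card (lattice_points p (g ^ k) (g ^ l) ((int m)\<^sup>2)))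
      \<le> c + 8 * real m * card (lattice_points p (g ^ k) (g ^ l) (int m))" for k l
  proof -
    have "int m \<le> (int m)\<^sup>2"
      using assms(3) by (simp add: power2_eq_square)
    then have "real (card (lattice_points p (g ^ k) (g ^ l) ((int m)\<^sup>2)))
        \<le> 16 * (real_of_int ((int m)\<^sup>2))\<^sup>2 / p + 4 * real_of_int ((int m)\<^sup>2) / real_of_int (int m)
          + 8 * (real_of_int ((int m)\<^sup>2) / real_of_int (int m)) * card (lattice_points p (g ^ k) (g ^ l) (int m))"
      using assms by (intro card_lattice_points_rescale) auto
    then show ?thesis
      using assms(3) by (simp add: power2_eq_square power4_eq_xxxx mult.assoc c_def)
  qed
  then have "real (card (power_collisions p g m ((int m)\<^sup>2)))
      \<le> (\<Sum>k=1..m. \<Sum>l=1..m. c + 8 * real m * card (lattice_points p (g ^ k) (g ^ l) (int m)))"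
    unfolding card_power_collisions of_nat_sum by (intro sum_mono)
  also have "\<dots> = real m * (real m * c) + 8 * real m * card (power_collisions p g m (int m))"
    by (simp add: sum.distrib card_power_collisions sum_distrib_left)
  also have "real m * (real m * c) = 16 * real m ^ 6 / p + 4 * real m ^ 3"
    by (simp add: c_def distrib_left power_numeral_reduce)
  finally show ?thesis .
qed

text \<open>With \<open>X = D\<^sup>2 m\<^sup>2 s\<close>, the Cauchy-Schwarz bound and the
  rescaling bound combine to \<open>J\<^sup>2 \<le> 20 X\<^sup>2 + 8 X J\<close>. This forces
  \<open>J \<le> 10 X\<close>, so \<open>J > 13 X\<close> is contradictory.\<close>

lemma card_power_collisions_le:
  fixes p g :: int and m :: nat and D s :: real
  assumes "prime p" and "coprime g p" and "m \<ge> 1" and "int m < p" and "D \<ge> 1" and "s \<ge> 1"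
    and inj: "\<And>k l. k \<in> {1..m} \<Longrightarrow> l \<in> {1..m} \<Longrightarrow> [g ^ k = g ^ l] (mod p) \<Longrightarrow> k = l"
    and D: "\<And>Z. Z \<noteq> 0 \<Longrightarrow> \<bar>Z\<bar> \<le> (int m)\<^sup>2 \<Longrightarrow> real (card {(x, y). x * y = Z}) \<le> D"
    and s: "real m ^ 3 \<le> p * s\<^sup>2"
  shows "real (card (power_collisions p g m (int m))) \<le> 13 * D\<^sup>2 * m\<^sup>2 * s"
proof (rule ccontr)
  define J where "J = real (card (power_collisions p g m (int m)))"
  define X where "X = D\<^sup>2 * (real m)\<^sup>2 * s"
  have p: "real_of_int p > 0"
    using assms(1) prime_gt_0_int by simp
  assume "\<not> ?thesis"
  then have J: "13 * X < J"
    by (simp add: J_def X_def mult.assoc)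
  have D2: "1 \<le> D\<^sup>2" and s2: "1 \<le> s\<^sup>2"
    using assms(5,6) by (simp_all add: one_le_power)
  have X: "X > 0"
    using assms(3,5,6) by (simp add: X_def)
  \<comment> \<open>The main term of the lattice count becomes \<open>m ^ 7 / p\<close> here; the
    hypothesis on \<open>m ^ 3\<close> brings it down to the order of
    \<open>X\<^sup>2\<close>.\<close>
  have "real m ^ 7 / p = real m ^ 4 * (real m ^ 3 / p)"
    by (simp add: power_numeral_reduce)
  also have "\<dots> \<le> real m ^ 4 * s\<^sup>2"
    using s p by (intro mult_left_mono) (simp_all add: divide_le_eq mult.commute)
  finally have m7: "real m ^ 7 / p \<le> real m ^ 4 * s\<^sup>2" .
  have "J\<^sup>2 \<le> real m * (D\<^sup>2 * card (power_collisions p g m ((int m)\<^sup>2)))"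
    unfolding J_def using assms by (intro card_power_collisions_squared_le) auto
  also have "\<dots> \<le> real m * (D\<^sup>2 * (16 * real m ^ 6 / p + 4 * real m ^ 3 + 8 * real m * J))"
    unfolding J_def using assms(2,3) p
    by (intro mult_left_mono card_power_collisions_rescale) simp_all
  also have "\<dots> = D\<^sup>2 * (16 * (real m ^ 7 / p)) + D\<^sup>2 * (4 * real m ^ 4) + 8 * (D\<^sup>2 * (real m)\<^sup>2) * J"
    by (simp add: algebra_simps power_numeral_reduce)
  also have "\<dots> \<le> D\<^sup>2 * (16 * (real m ^ 4 * s\<^sup>2)) + D\<^sup>2 * (4 * (real m ^ 4 * s\<^sup>2)) + 8 * X * J"
  proof (intro add_mono mult_left_mono mult_right_mono m7)
    show "real m ^ 4 \<le> real m ^ 4 * s\<^sup>2"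
      using s2 by (simp add: mult_le_cancel_left1)
    show "D\<^sup>2 * (real m)\<^sup>2 \<le> X"
      unfolding X_def using assms(6) mult_left_mono[of 1 s "D\<^sup>2 * (real m)\<^sup>2"] by simp
  qed (auto simp: J_def)
  also have "\<dots> = 20 * (D\<^sup>2 * real m ^ 4 * s\<^sup>2) + 8 * X * J"
    by simp
  also have "D\<^sup>2 * real m ^ 4 * s\<^sup>2 \<le> D\<^sup>2 * (D\<^sup>2 * real m ^ 4 * s\<^sup>2)"
    using D2 by (intro mult_right_mono[of 1 "D\<^sup>2", simplified]) auto
  also have "D\<^sup>2 * (D\<^sup>2 * real m ^ 4 * s\<^sup>2) = X * X"
    by (simp add: X_def power2_eq_square power4_eq_xxxx)
  finally have "J * J \<le> 20 * (X * X) + 8 * X * J"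
    by (simp add: power2_eq_square)
  moreover have "X * (13 * X) \<le> X * J" "13 * X * J \<le> J * J"
    using J X by (auto intro!: mult_left_mono mult_right_mono)
  moreover have "X * X > 0"
    using X by simp
  ultimately show False
    by (simp add: mult.assoc)
qed

text \<open>Cauchy-Schwarz for the products \<open>x g\<^sup>k\<close>. For fixed exponents,
  subtracting one collision from the others makes the position \<open>u\<close> of the interval
  disappear; the summand \<open>m\<^sup>2\<close> counts the zero difference once for each pair of
  exponents.\<close>

lemma card_interval_power_products_ge:
  fixes p g u :: int and m :: nat
  assumes "coprime g p"
  defines "A \<equiv> (\<lambda>(x, k). (x * g ^ k) mod p) ` ({u + 1..u + int m} \<times> {1..m})"
  shows "(m * m)\<^sup>2 \<le> card A * (m\<^sup>2 + card (power_collisions p g m (int m)))"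
proof -
  define I where "I = {u + 1..u + int m}"
  define f where "f = (\<lambda>(x, k). (x * g ^ k) mod p)"
  define C where "C = {(s, t) \<in> (I \<times> {1..m}) \<times> (I \<times> {1..m}). f s = f t}"
  define E where "E k l = {(x, y) \<in> I \<times> I. p dvd x * g ^ k - y * g ^ l}" for k l
  have finE: "finite (E k l)" for k l
    by (rule finite_subset[of _ "I \<times> I"]) (auto simp: E_def I_def)
  have E: "card (E k l) \<le> 1 + card (lattice_points p (g ^ k) (g ^ l) (int m))" for k l
  proof (cases "E k l = {}")
    case False
    then obtain x0 y0 where xy0: "(x0, y0) \<in> E k l"
      by auto
    have "(\<lambda>(x, y). (x - x0, y - y0)) ` E k l \<subseteq> insert (0, 0) (lattice_points p (g ^ k) (g ^ l) (int m))"
    proof clarify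
      fix x y
      assume xy: "(x, y) \<in> E k l" and "(x - x0, y - y0) \<notin> lattice_points p (g ^ k) (g ^ l) (int m)"
      moreover have "\<bar>x - x0\<bar> \<le> int m" "\<bar>y - y0\<bar> \<le> int m"
        using xy xy0 by (auto simp: E_def I_def)
      moreover have "p dvd x * g ^ k - y * g ^ l" "p dvd x0 * g ^ k - y0 * g ^ l"
        using xy xy0 by (auto simp: E_def)
      then have "p dvd (x * g ^ k - y * g ^ l) - (x0 * g ^ k - y0 * g ^ l)"
        by (rule dvd_diff)
      then have "p dvd (x - x0) * g ^ k - (y - y0) * g ^ l"
        by (simp add: algebra_simps)
      ultimately show "x - x0 = 0 \<and> y - y0 = 0"
        by (auto simp: lattice_points_def)
    qed
    then have "card (E k l) \<le> card (insert (0, 0) (lattice_points p (g ^ k) (g ^ l) (int m)))"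
      by (intro card_inj_on_le[of "\<lambda>(x, y). (x - x0, y - y0)"]) (auto simp: inj_on_def)
    also have "\<dots> \<le> 1 + card (lattice_points p (g ^ k) (g ^ l) (int m))"
      by (simp add: card_insert_if)
    finally show ?thesis .
  qed simp
  have "card C = card (SIGMA k:{1..m}. SIGMA l:{1..m}. E k l)"
    by (rule bij_betw_same_card[of "\<lambda>((x, k), (y, l)). (k, l, x, y)"],
        rule bij_betwI[where g = "\<lambda>(k, l, x, y). ((x, k), (y, l))"])
       (auto simp: C_def E_def f_def mod_eq_dvd_iff)
  also have "\<dots> = (\<Sum>k=1..m. \<Sum>l=1..m. card (E k l))"
    using finE by (simp add: card_SigmaI)
  also have "\<dots> \<le> (\<Sum>k=1..m. \<Sum>l=1..m. 1 + card (lattice_points p (g ^ k) (g ^ l) (int m)))"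
    by (intro sum_mono E)
  also have "\<dots> = m\<^sup>2 + card (power_collisions p g m (int m))"
    by (simp only: sum.distrib card_power_collisions) (simp add: power2_eq_square)
  finally have C: "card C \<le> m\<^sup>2 + card (power_collisions p g m (int m))" .
  have "(card (I \<times> {1..m}))\<^sup>2 \<le> card (f ` (I \<times> {1..m})) * card C"
    unfolding C_def by (rule card_squared_le_image_times_collisions) (simp add: I_def)
  also have "\<dots> \<le> card A * (m\<^sup>2 + card (power_collisions p g m (int m)))"
    using C by (simp add: A_def f_def I_def)
  finally show ?thesis
    by (simp add: card_cartesian_product I_def)
qed

subsection \<open>Powers with integer exponents\<close>

text \<open>For \<open>y = - (n + 1)\<close> both sides become 1 after multiplication by
  \<open>g ^ n\<close>, which can be cancelled.\<close>

lemma mod_powi_add_one: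
  assumes "coprime g p"
  shows "[mod_powi p g (y + 1) = mod_powi p g y * g] (mod p)"
proof (cases "y \<ge> 0")
  case True
  then show ?thesis
    by (simp add: mod_powi_def nat_add_distrib mult.commute)
next
  case False
  then obtain n where y: "y = - int (Suc n)"
    using negD[of y] by auto
  have "[mod_powi p g (y + 1) * g ^ n = 1] (mod p)"
    using mod_powi_minus_cong[OF assms, of n] y by simp
  moreover have "[mod_powi p g y * g * g ^ n = 1] (mod p)"
    using mod_powi_minus_cong[OF assms, of "Suc n"] y by (simp add: mult.assoc)
  ultimately have "[mod_powi p g (y + 1) * g ^ n = mod_powi p g y * g * g ^ n] (mod p)"
    by (metis cong_sym cong_trans)
  then show ?thesis
    using assms by (simp add: cong_mult_rcancel)
qed

lemma mod_powi_add_nat: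
  assumes "coprime g p"
  shows "[mod_powi p g (y + int k) = mod_powi p g y * g ^ k] (mod p)"
proof (induction k)
  case (Suc k)
  have "[mod_powi p g (y + int k + 1) = mod_powi p g (y + int k) * g] (mod p)"
    by (rule mod_powi_add_one[OF assms])
  also have "[mod_powi p g (y + int k) * g = mod_powi p g y * g ^ k * g] (mod p)"
    by (rule cong_mult[OF Suc.IH cong_refl])
  finally show ?case
    by (simp add: algebra_simps)
qed simp

lemma coprime_mod_powi:
  assumes "coprime g p"
  shows "coprime (mod_powi p g y) p"
proof (cases "y \<ge> 0")
  case True
  then show ?thesis
    using assms by (simp add: mod_powi_def)
next
  case False
  then obtain k where "y = - int k"
    by (metis int_cases2 linorder_le_cases of_nat_0_le_iff)
  then show ?thesis
    using mod_powi_minus_cong[OF assms, of k] by (auto simp: coprime_iff_invertible_int)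
qed

text \<open>The exponents differ by less than the order. Cancelling the smaller power leaves
  \<open>g\<close> to their difference congruent to 1, so minimality of the order makes the
  difference zero.\<close>

lemma power_cong_imp_eq:
  fixes g p :: int
  assumes "coprime g p" and "k < l + ord p g" and "l < k + ord p g" and "[g ^ k = g ^ l] (mod p)"
  shows "k = l"
  using assms(2-4)
proof (induction k l rule: linorder_wlog)
  case (le k l)
  have "g ^ l = g ^ (l - k) * g ^ k"
    using le(1) by (simp flip: power_add)
  then have "[g ^ (l - k) * g ^ k = 1 * g ^ k] (mod p)"
    using le(4) by (simp add: cong_sym)
  then have "[g ^ (l - k) = 1] (mod p)"
    using assms(1) cong_mult_rcancel[of "g ^ k" p "g ^ (l - k)" 1] by simp
  moreover have "l - k < (LEAST d. d > 0 \<and> [g ^ d = 1] (mod p))"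
    using le(1,3) assms(1) by (simp add: ord_def coprime_commute)
  ultimately show ?case
    using not_less_Least le(1) by fastforce
next
  case (sym k l)
  then show ?case
    by (simp add: cong_sym)
qed

text \<open>If \<open>g\<^sup>k \<equiv> - g\<^sup>l\<close>, squaring gives equal powers with
  exponents \<open>2 * k\<close> and \<open>2 * l\<close>, hence \<open>k = l\<close> and
  \<open>p\<close> divides \<open>2 * g ^ k\<close>. This keeps the set of powers disjoint from its
  negative.\<close>

lemma power_sum_not_dvd:
  fixes g p :: int
  assumes "prime p" and "p > 2" and "coprime g p"
    and "2 * k < 2 * l + ord p g" and "2 * l < 2 * k + ord p g"
  shows "\<not> p dvd g ^ k + g ^ l"
proof
  assume "p dvd g ^ k + g ^ l"
  then have dvd: "p dvd (g ^ k + g ^ l) * (g ^ k - g ^ l)" and "[g ^ k = - (g ^ l)] (mod p)"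
    by (simp_all add: cong_iff_dvd_diff)
  have double: "g ^ (2 * k) = g ^ k * g ^ k" for k
    by (simp add: mult_2 power_add)
  have "g ^ (2 * k) - g ^ (2 * l) = (g ^ k + g ^ l) * (g ^ k - g ^ l)"
    unfolding double by (simp add: algebra_simps)
  then have "[g ^ (2 * k) = g ^ (2 * l)] (mod p)"
    using dvd by (simp add: cong_iff_dvd_diff)
  then have "k = l"
    using power_cong_imp_eq[OF assms(3-5)] by simp
  then have "p dvd 2 * g ^ k"
    using \<open>p dvd g ^ k + g ^ l\<close> by simp
  then have "p dvd 2"
    using assms(3) by (simp add: coprime_commute coprime_dvd_mult_left_iff)
  then show False
    using assms(2) zdvd_imp_le by fastforce
qed

subsection \<open>Representation by eight terms\<close>

text \<open>The collision bound gives \<open>|A| \<ge> m\<^sup>2 / (14 D\<^sup>2 s)\<close>, while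
  \<open>|B| = m\<close>. Hence \<open>|A| |B| \<ge> p s / (378 D\<^sup>2) \<ge> 2 p\<close>, where
  \<open>378 = 27 * 14\<close> and \<open>756 = 2 * 378\<close>. The order is at least
  \<open>2 * m\<close> so that the powers in \<open>B\<close> are distinct and no two of them are
  opposite.\<close>

lemma eightfold_interval_power_sum:
  fixes p g u lam :: int and m :: nat and D s :: real
  assumes "prime p" and "p \<ge> 5" and "coprime g p" and "m \<ge> 1" and "int m < p"
    and ord: "2 * m \<le> ord p g"
    and "D \<ge> 1" and "s \<ge> 756 * D\<^sup>2"
    and D: "\<And>Z. Z \<noteq> 0 \<Longrightarrow> \<bar>Z\<bar> \<le> (int m)\<^sup>2 \<Longrightarrow> real (card {(x, y). x * y = Z}) \<le> D"
    and upper: "real m ^ 3 \<le> p * s\<^sup>2" and lower: "p * s\<^sup>2 \<le> 27 * real m ^ 3"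
  shows "\<exists>xs. length xs = 8 \<and> set xs \<subseteq> {u + 1..u + int m} \<times> {1..2 * m} \<and>
    [(\<Sum>(x, k)\<leftarrow>xs. x * g ^ k) = lam] (mod p)"
proof -
  define A where "A = (\<lambda>(x, k). (x * g ^ k) mod p) ` ({u + 1..u + int m} \<times> {1..m})"
  define B where "B = (\<lambda>k. g ^ k mod p) ` {..<m}"
  have p: "p > 0" "real_of_int p > 0"
    using assms(2) by simp_all
  have D2: "1 \<le> D\<^sup>2"
    using assms(7) by (simp add: one_le_power)
  then have s: "s \<ge> 1"
    using assms(8) by linarith
  have AB: "A \<subseteq> {0..<p}" "B \<subseteq> {0..<p}"
    using p by (auto simp: A_def B_def)
  have "inj_on (\<lambda>k. g ^ k mod p) {..<m}"
  proof (rule inj_onI)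
    fix k l
    assume "k \<in> {..<m}" "l \<in> {..<m}" "g ^ k mod p = g ^ l mod p"
    then show "k = l"
      using power_cong_imp_eq[OF assms(3), of k l] ord by (simp add: cong_def)
  qed
  then have cB: "card B = m"
    by (simp add: B_def card_image)
  have J: "real (card (power_collisions p g m (int m))) \<le> 13 * D\<^sup>2 * (real m)\<^sup>2 * s"
    using card_power_collisions_le[OF assms(1,3,4,5,7) s _ D upper]
      power_cong_imp_eq[OF assms(3)] ord by fastforce
  have "1 * 1 \<le> D\<^sup>2 * s"
    using D2 s by (intro mult_mono) auto
  then have "(real m)\<^sup>2 * 1 \<le> (real m)\<^sup>2 * (D\<^sup>2 * s)"
    by (intro mult_left_mono) auto
  \<comment> \<open>The 14 is 13 plus 1: the diagonal term is absorbed because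
    \<open>D\<^sup>2 * s \<ge> 1\<close>.\<close>
  then have J': "(real m)\<^sup>2 + real (card (power_collisions p g m (int m))) \<le> (real m)\<^sup>2 * (14 * D\<^sup>2 * s)"
    using J by (simp add: algebra_simps)
  have "(m * m)\<^sup>2 \<le> card A * (m\<^sup>2 + card (power_collisions p g m (int m)))"
    unfolding A_def by (rule card_interval_power_products_ge[OF assms(3)])
  then have "real ((m * m)\<^sup>2) \<le> real (card A * (m\<^sup>2 + card (power_collisions p g m (int m))))"
    by (simp only: of_nat_le_iff)
  also have "\<dots> = real (card A) * ((real m)\<^sup>2 + real (card (power_collisions p g m (int m))))"
    by simp
  also have "\<dots> \<le> real (card A) * ((real m)\<^sup>2 * (14 * D\<^sup>2 * s))"
    using J' by (intro mult_left_mono) auto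
  finally have "(real m)\<^sup>2 * (real m)\<^sup>2 \<le> (real m)\<^sup>2 * (real (card A) * (14 * D\<^sup>2 * s))"
    by (simp add: power2_eq_square mult_ac)
  then have "(real m)\<^sup>2 \<le> real (card A) * (14 * D\<^sup>2 * s)"
    by (rule mult_left_le_imp_le) (use assms(4) in simp)
  then have "(real m)\<^sup>2 * real m \<le> real (card A) * (14 * D\<^sup>2 * s) * real m"
    by (intro mult_right_mono) auto
  then have "real m ^ 3 \<le> real (card A * card B) * (14 * D\<^sup>2 * s)"
    by (simp add: cB power_numeral_reduce mult_ac)
  then have "p * s\<^sup>2 \<le> 27 * (real (card A * card B) * (14 * D\<^sup>2 * s))"
    using lower by linarith
  then have "s * (p * s) \<le> s * (real (card A * card B) * (378 * D\<^sup>2))"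
    by (simp add: power2_eq_square mult_ac)
  then have "p * s \<le> real (card A * card B) * (378 * D\<^sup>2)"
    by (rule mult_left_le_imp_le) (use s in simp)
  moreover have "p * (756 * D\<^sup>2) \<le> p * s"
    using assms(8) p by (intro mult_left_mono) auto
  ultimately have "(378 * D\<^sup>2) * (2 * real_of_int p) \<le> (378 * D\<^sup>2) * real (card A * card B)"
    by (simp add: mult_ac)
  then have "2 * real_of_int p \<le> real (card A * card B)"
    by (rule mult_left_le_imp_le) (use assms(7) in simp)
  then have large: "2 * p \<le> int (card A * card B)"
    by linarith
  have anti: "\<not> p dvd b + b'" if b: "b \<in> B" "b' \<in> B" for b b'
  proof -
    obtain k l where "k < m" "l < m" "b = g ^ k mod p" "b' = g ^ l mod p"
      using b by (auto simp: B_def)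
    then show ?thesis
      using power_sum_not_dvd[OF assms(1) _ assms(3), of k l] assms(2) ord
      by (simp add: dvd_eq_mod_eq_0 mod_simps)
  qed
  obtain xs where xs: "length xs = 8" "set xs \<subseteq> A \<times> B" "[(\<Sum>(a, b)\<leftarrow>xs. a * b) = lam] (mod p)"
    using eightfold_sum_of_products[OF assms(1,2) AB large anti] by metis
  \<comment> \<open>Each product of residues is turned back into \<open>x * g ^ (k + l)\<close>.
    With \<open>1 \<le> k \<le> m\<close> and \<open>0 \<le> l < m\<close> the exponent stays in the
    allowed range.\<close>
  have "\<exists>y. y \<in> {u + 1..u + int m} \<times> {1..2 * m} \<and> [fst z * snd z = fst y * g ^ snd y] (mod p)"
    if "z \<in> A \<times> B" for z
  proof -
    obtain x k l where "x \<in> {u + 1..u + int m}" "k \<in> {1..m}" "l < m"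
      and z: "fst z = (x * g ^ k) mod p" "snd z = g ^ l mod p"
      using \<open>z \<in> A \<times> B\<close> by (auto simp: A_def B_def)
    moreover have "[fst z * snd z = x * g ^ (k + l)] (mod p)"
      unfolding z cong_def by (simp add: mod_simps power_add mult.assoc)
    ultimately show ?thesis
      by (intro exI[of _ "(x, k + l)"]) auto
  qed
  then obtain h where h: "h z \<in> {u + 1..u + int m} \<times> {1..2 * m}"
    "[fst z * snd z = fst (h z) * g ^ snd (h z)] (mod p)" if "z \<in> A \<times> B" for z
    by metis
  have "[(\<Sum>(a, b)\<leftarrow>ys. a * b) = (\<Sum>(x, k)\<leftarrow>map h ys. x * g ^ k)] (mod p)"
    if "set ys \<subseteq> A \<times> B" for ys
    using that
  proof (induction ys)
    case (Cons z ys)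
    then show ?case
      using cong_add[OF h(2)[of z] Cons.IH] by (simp add: case_prod_unfold)
  qed simp
  then have "[(\<Sum>(x, k)\<leftarrow>map h xs. x * g ^ k) = lam] (mod p)"
    using xs by (metis cong_sym cong_trans)
  moreover have "set (map h xs) \<subseteq> {u + 1..u + int m} \<times> {1..2 * m}"
    unfolding set_map by (rule image_subsetI) (use h(1) xs(2) in blast)
  ultimately show ?thesis
    using xs(1) by (intro exI[of _ "map h xs"]) simp
qed

section \<open>Choice of parameters and shift of the exponents\<close>

theorem theorem3:
  fixes \<epsilon> :: real
  assumes "\<epsilon> > 0"
  shows "\<exists>p\<^sub>0 :: int. \<forall>(p :: int) (g :: int) (T :: nat) (u :: int) (v :: int) (N :: nat) (M :: nat).
    p \<ge> p\<^sub>0 \<and> prime p \<and> coprime g p \<and> T = ord p g \<and>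
    int N \<le> p \<and> M \<le> T \<and>
    real N > real_of_int p powr (1 / 3 + \<epsilon>) \<and>
    real M > real_of_int p powr (1 / 3 + \<epsilon>) \<longrightarrow>
    (\<forall>lam :: int. \<exists>(x :: nat \<Rightarrow> int) (y :: nat \<Rightarrow> int).
       (\<forall>i \<in> {1..8}. x i \<in> {u + 1..u + int N} \<and> y i \<in> {v + 1..v + int M}) \<and>
       [(\<Sum>i = 1..8. x i * mod_powi p g (y i)) = lam] (mod p))"
proof -
  \<comment> \<open>The divisor bound for integers up to \<open>q\<^sup>2\<close> then costs
    \<open>D\<^sup>2 = 4 C\<^sup>2 q powr (\<epsilon> / 2)\<close>, which is smaller than
    \<open>s\<close> by a factor of order \<open>q powr \<epsilon>\<close>.\<close>
  define \<delta> where "\<delta> = \<epsilon> / 8"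
  have "\<delta> > 0"
    using assms by (simp add: \<delta>_def)
  then obtain C :: real where C: "C \<ge> 1"
    and divisors: "\<And>n::nat. n > 0 \<Longrightarrow> real (card {d. d dvd n}) \<le> C * real n powr \<delta>"
    using card_divisors_le_powr by metis
  \<comment> \<open>\<open>216 = 6 ^ 3\<close> ensures \<open>P \<ge> 6\<close>, hence
    \<open>P \<le> 3 * m\<close> despite the rounding in \<open>m\<close>. The other bound, with
    \<open>3024 = 4 * 756\<close>, gives \<open>s \<ge> 756 * D\<^sup>2\<close>.\<close>
  define p0 :: int where "p0 = max 216 \<lceil>(3024 * C\<^sup>2) powr (1 / \<epsilon>)\<rceil>"
  show ?thesis
  proof (intro exI[of _ p0] allI impI, elim conjE)
    fix p g u v lam :: int and T N M :: nat
    assume "p \<ge> p0" and "prime p" and g: "coprime g p" and T: "T = ord p g"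
      and N: "int N \<le> p" "real N > real_of_int p powr (1 / 3 + \<epsilon>)"
      and M: "M \<le> T" "real M > real_of_int p powr (1 / 3 + \<epsilon>)"
    define q where "q = real_of_int p"
    define P where "P = q powr (1 / 3 + \<epsilon>)"
    \<comment> \<open>Half of \<open>P\<close>, since sums of two exponents up to \<open>m\<close>
      must fit into an interval of length \<open>M\<close>.\<close>
    define m where "m = nat \<lfloor>P / 2\<rfloor>"
    define D where "D = 2 * C * q powr (2 * \<delta>)"
    \<comment> \<open>The excess of \<open>P\<close> over the cube root of \<open>q\<close>: this
      makes \<open>P ^ 3 = q * s\<^sup>2\<close>.\<close>
    define s where "s = q powr (3 * \<epsilon> / 2)"
    have p: "p \<ge> 216" and q: "q \<ge> 216" "q > 0"
      using \<open>p \<ge> p0\<close> by (auto simp: p0_def q_def)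
    have qC: "(3024 * C\<^sup>2) powr (1 / \<epsilon>) \<le> q"
      using \<open>p \<ge> p0\<close> unfolding p0_def q_def by linarith
    have "(6::real) = (6 ^ 3) powr (1 / 3)"
      by (subst powr_realpow[symmetric]) (simp_all add: powr_powr)
    also have "\<dots> \<le> q powr (1 / 3)"
      using q by (intro powr_mono2) auto
    also have "\<dots> \<le> P"
      unfolding P_def using q assms by (intro powr_mono) auto
    finally have P: "P \<ge> 6" .
    have m: "2 * real m \<le> P" "P \<le> 3 * real m"
      using P unfolding m_def by linarith+
    have "2 * real m < real N" "2 * real m < real M"
      using m N M by (auto simp: P_def q_def)
    then have mN: "m < N" "1 \<le> m" "2 * m \<le> M"
      using m P by linarith+
    have P3: "P ^ 3 = q * s\<^sup>2"
    proof -
      have "P ^ 3 = q powr (1 + 3 * \<epsilon>)"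
        using q by (simp add: P_def powr_realpow[symmetric] powr_powr algebra_simps)
      also have "\<dots> = q * s\<^sup>2"
        using q by (simp add: s_def powr_add powr_realpow[symmetric] powr_powr)
      finally show ?thesis .
    qed
    have "real m ^ 3 \<le> (P / 2) ^ 3"
      using m by (intro power_mono) auto
    then have "8 * real m ^ 3 \<le> p * s\<^sup>2"
      using P3 by (simp add: q_def power_divide field_simps)
    moreover have "0 \<le> real m ^ 3"
      by simp
    ultimately have upper: "real m ^ 3 \<le> p * s\<^sup>2"
      by linarith
    have "P ^ 3 \<le> (3 * real m) ^ 3"
      using m P by (intro power_mono) auto
    then have lower: "p * s\<^sup>2 \<le> 27 * real m ^ 3"
      using P3 by (simp add: q_def power_mult_distrib)
    have q1: "q powr (2 * \<delta>) \<ge> 1"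
      using q \<open>\<delta> > 0\<close> by (intro ge_one_powr_ge_zero) auto
    have "1 * 1 \<le> C * q powr (2 * \<delta>)"
      using q1 C by (intro mult_mono) auto
    then have D1: "D \<ge> 1"
      by (simp add: D_def)
    have "3024 * C\<^sup>2 = ((3024 * C\<^sup>2) powr (1 / \<epsilon>)) powr \<epsilon>"
      using assms C by (simp add: powr_powr)
    also have "\<dots> \<le> q powr \<epsilon>"
      using assms qC by (intro powr_mono2) auto
    finally have "3024 * C\<^sup>2 * q powr (\<epsilon> / 2) \<le> q powr \<epsilon> * q powr (\<epsilon> / 2)"
      by (intro mult_right_mono) auto
    moreover have "q powr \<epsilon> * q powr (\<epsilon> / 2) = s"
      using q by (simp add: s_def powr_add[symmetric])
    moreover have "(q powr (2 * \<delta>))\<^sup>2 = q powr (\<epsilon> / 2)"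
      using q by (simp add: \<delta>_def powr_realpow[symmetric] powr_powr)
    ultimately have s: "s \<ge> 756 * D\<^sup>2"
      by (simp add: D_def power_mult_distrib)
    have D: "real (card {(x, y). x * y = Z}) \<le> D" if Z: "Z \<noteq> 0" "\<bar>Z\<bar> \<le> (int m)\<^sup>2" for Z
    proof -
      have "real_of_int \<bar>Z\<bar> \<le> (real m)\<^sup>2"
        using Z(2) by (metis of_int_le_iff of_int_of_nat_eq of_int_power)
      also have "\<dots> \<le> q\<^sup>2"
        using mN(1) N(1) unfolding q_def by (intro power_mono) linarith+
      finally have "real (nat \<bar>Z\<bar>) powr \<delta> \<le> (q\<^sup>2) powr \<delta>"
        using \<open>\<delta> > 0\<close> by (intro powr_mono2) auto
      also have "\<dots> = q powr (2 * \<delta>)"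
        using q powr_powr[of q 2 \<delta>] by simp
      finally have "C * real (nat \<bar>Z\<bar>) powr \<delta> \<le> C * q powr (2 * \<delta>)"
        using C by (intro mult_left_mono) auto
      moreover have "real (card {(x, y). x * y = Z}) \<le> 2 * real (card {d. d dvd nat \<bar>Z\<bar>})"
        using card_factorizations_le[OF Z(1)] by linarith
      moreover have "real (card {d. d dvd nat \<bar>Z\<bar>}) \<le> C * real (nat \<bar>Z\<bar>) powr \<delta>"
        using Z(1) by (intro divisors) simp
      ultimately show ?thesis
        unfolding D_def by linarith
    qed
    \<comment> \<open>The start \<open>v\<close> of the exponent interval is removed by dividing
      \<open>lam\<close> by the unit \<open>c\<close>; the positive exponents found for
      \<open>mu\<close> are shifted by \<open>v\<close> afterwards.\<close>
    define c where "c = mod_powi p g v"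
    have "coprime c p"
      unfolding c_def by (rule coprime_mod_powi[OF g])
    then obtain mu where mu: "[c * mu = lam] (mod p)"
      by (metis cong_solve_coprime_int cong_scalar_right mult.assoc mult_1)
    obtain xs where xs: "length xs = 8" "set xs \<subseteq> {u + 1..u + int m} \<times> {1..2 * m}"
      "[(\<Sum>(x, k)\<leftarrow>xs. x * g ^ k) = mu] (mod p)"
      using eightfold_interval_power_sum[OF \<open>prime p\<close> _ g mN(2) _ _ D1 s D upper lower, of u mu]
        p mN M(1) N(1) T by force
    define x where "x i = fst (xs ! (i - 1))" for i
    define k where "k i = snd (xs ! (i - 1))" for i
    have mem: "x i \<in> {u + 1..u + int m} \<and> k i \<in> {1..2 * m}" if "i \<in> {1..8}" for i
    proof -
      have "xs ! (i - 1) \<in> set xs"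
        using that xs(1) by (intro nth_mem) auto
      then have "xs ! (i - 1) \<in> {u + 1..u + int m} \<times> {1..2 * m}"
        using xs(2) by blast
      then show ?thesis
        by (simp add: x_def k_def mem_Times_iff)
    qed
    have "(\<Sum>(x, k)\<leftarrow>xs. x * g ^ k) = (\<Sum>i<8. fst (xs ! i) * g ^ snd (xs ! i))"
      using xs(1) by (simp add: sum_list_sum_nth atLeast0LessThan case_prod_unfold)
    also have "\<dots> = (\<Sum>i=1..8. x i * g ^ k i)"
      by (rule sum.reindex_bij_witness[of _ "\<lambda>i. i - 1" Suc]) (auto simp: x_def k_def)
    finally have sum: "[(\<Sum>i=1..8. x i * g ^ k i) = mu] (mod p)"
      using xs(3) by simp
    have "[(\<Sum>i=1..8. x i * mod_powi p g (v + int (k i))) = (\<Sum>i=1..8. x i * (c * g ^ k i))] (mod p)"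
      unfolding c_def by (intro cong_sum cong_mult cong_refl mod_powi_add_nat g)
    also have "(\<Sum>i=1..8. x i * (c * g ^ k i)) = c * (\<Sum>i=1..8. x i * g ^ k i)"
      by (simp add: sum_distrib_left mult.left_commute)
    also have "[\<dots> = c * mu] (mod p)"
      using sum by (rule cong_scalar_left)
    also have "[c * mu = lam] (mod p)"
      by (rule mu)
    finally have "[(\<Sum>i=1..8. x i * mod_powi p g (v + int (k i))) = lam] (mod p)" .
    moreover have "\<forall>i\<in>{1..8}. x i \<in> {u + 1..u + int N} \<and> v + int (k i) \<in> {v + 1..v + int M}"
      using mem mN by fastforce
    ultimately show "\<exists>(x :: nat \<Rightarrow> int) (y :: nat \<Rightarrow> int). (\<forall>i\<in>{1..8}. x i \<in> {u + 1..u + int N} \<and> y i \<in> {v + 1..v + int M}) \<and>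
        [(\<Sum>i=1..8. x i * mod_powi p g (y i)) = lam] (mod p)"
      by (intro exI[of _ x] exI[of _ "\<lambda>i. v + int (k i)"]) blast
  qed
qed

end
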